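(* Let $r\ge 3$, $u\ge 2$ and $\ell\ge 1$ be integers, $k=r(u-1)$ and $q=(r-1)(u-1)$. Let $H$ be a connected $r$-regular $u$-uniform hypergraph of girth at least $3$ and order $v$. If the second eigenvalue $\tau_2$ of $H$ is at most $u-2+2\sqrt q-\frac{2\sqrt q-1}{\ell}$, then $$v\le 1+\sum_{j=0}^{2\ell-1}kq^j.$$ Equality holds only if $(r,u,\ell)=(3,2,1)$, and in that case the Petersen graph attains the bound.
   Context: A hypergraph $H=(V,E)$ consists of a finite vertex set $V$ and a set $E$ of subsets of $V$ (edges), each of size at least 2 (no repeated edges). It is $u$-uniform if every edge has exactly $u$ vertices and $r$-regular if every vertex is in exactly $r$ edges. A walk of length $p$ is a sequence $(x_0,e_1,x_1,\ldots,e_p,x_p)$ of vertices and edges with $x_{i-1},x_i\in e_i$, $x_{i-1}\ne x_i$; $H$ is connected if any two vertices are joined by a walk. The girth is the minimum length of a Berge cycle (a walk with $x_0=x_p$ with all edges distinct and all vertices distinct except $x_0=x_p$); girth at least 3 means any two distinct vertices lie in at most one common edge. The order is $|V|$. The adjacency matrix has entries $A_{xy}=|\{e\in E:\{x,y\}\subset e\}|$ for $x\neq y$ and $A_{xx}=0$; the eigenvalues of $H$ are those of $A$, and the second eigenvalue is the second largest one (with multiplicity). A graph is regarded as a $2$-uniform hypergraph. *)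

theory Defs
  imports
    "HOL-Library.Extended_Nat"
    "Jordan_Normal_Form.Char_Poly"
    Complex_Main
begin

definition hypergraph :: "'a set \<Rightarrow> 'a set set \<Rightarrow> bool" where
  "hypergraph V E \<longleftrightarrow> finite V \<and> (\<forall>e\<in>E. e \<subseteq> V \<and> card e \<ge> 2)"

definition uniform_hg :: "nat \<Rightarrow> 'a set set \<Rightarrow> bool" where
  "uniform_hg u E \<longleftrightarrow> (\<forall>e\<in>E. card e = u)"

definition regular_hg :: "nat \<Rightarrow> 'a set \<Rightarrow> 'a set set \<Rightarrow> bool" where
  "regular_hg r V E \<longleftrightarrow> (\<forall>x\<in>V. card {e\<in>E. x \<in> e} = r)"

text \<open>
  The walk \<open>(x\<^sub>0, e\<^sub>1, x\<^sub>1, \<dots>, e\<^sub>p, x\<^sub>p)\<close> is encoded by the list \<open>xs\<close> of its \<open>p + 1\<close> vertices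
  and the list \<open>es\<close> of its \<open>p\<close> edges, so \<open>e\<^sub>i\<^sub>+\<^sub>1\<close> is \<open>es ! i\<close> and the length of the walk is \<open>length es\<close>.
\<close>

definition walk_hg :: "'a set \<Rightarrow> 'a set set \<Rightarrow> 'a list \<Rightarrow> 'a set list \<Rightarrow> bool" where
  "walk_hg V E xs es \<longleftrightarrow>
     length xs = length es + 1 \<and> set xs \<subseteq> V \<and> set es \<subseteq> E \<and>
     (\<forall>i<length es. xs ! i \<in> es ! i \<and> xs ! Suc i \<in> es ! i \<and> xs ! i \<noteq> xs ! Suc i)"

definition connected_hg :: "'a set \<Rightarrow> 'a set set \<Rightarrow> bool" where
  "connected_hg V E \<longleftrightarrow>
     (\<forall>x\<in>V. \<forall>y\<in>V. \<exists>xs es. walk_hg V E xs es \<and> hd xs = x \<and> last xs = y)"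

text \<open>The walk of length 0 is not a cycle.\<close>

definition berge_cycle :: "'a set \<Rightarrow> 'a set set \<Rightarrow> 'a list \<Rightarrow> 'a set list \<Rightarrow> bool" where
  "berge_cycle V E xs es \<longleftrightarrow>
     walk_hg V E xs es \<and> es \<noteq> [] \<and> hd xs = last xs \<and> distinct (butlast xs) \<and> distinct es"

text \<open>The girth is \<open>\<infinity>\<close> if there is no Berge cycle.\<close>

definition girth_hg :: "'a set \<Rightarrow> 'a set set \<Rightarrow> enat" where
  "girth_hg V E = Inf {enat (length es) | xs es. berge_cycle V E xs es}"

definition adjacency_matrix :: "'a list \<Rightarrow> 'a set set \<Rightarrow> real mat" where
  "adjacency_matrix vs E = mat (length vs) (length vs)
     (\<lambda>(i, j). if i = j then 0 else real (card {e\<in>E. {vs ! i, vs ! j} \<subseteq> e}))"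

text \<open>
  The vertices are listed in an arbitrary order; another order conjugates the adjacency matrix by a
  permutation matrix and leaves its characteristic polynomial unchanged.  The matrix is real
  symmetric, so its characteristic polynomial splits over the reals, and the roots counted with
  multiplicity are all \<open>card V\<close> eigenvalues.
\<close>

definition eigenvalues_hg :: "'a set \<Rightarrow> 'a set set \<Rightarrow> real multiset" where
  "eigenvalues_hg V E =
     proots (char_poly (adjacency_matrix (SOME vs. distinct vs \<and> set vs = V) E))"

text \<open>Meaningful only if \<open>card V \<ge> 2\<close>.\<close>

definition second_eigenvalue :: "'a set \<Rightarrow> 'a set set \<Rightarrow> real" where
  "second_eigenvalue V E = rev (sorted_list_of_multiset (eigenvalues_hg V E)) ! 1"

text \<open>The Petersen graph, as the Kneser graph of the 2-subsets of a 5-element set.\<close>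

definition petersen_verts :: "nat set set" where
  "petersen_verts = {A. A \<subseteq> {..<5} \<and> card A = 2}"

definition petersen_edges :: "nat set set set" where
  "petersen_edges = {{A, B} | A B. A \<in> petersen_verts \<and> B \<in> petersen_verts \<and> A \<inter> B = {}}"

end

theory Submission
  imports Defs "HOL-Analysis.Function_Topology"
begin

text \<open>
  Put \<open>\<kappa> = k - \<beta>\<close>, where \<open>\<beta>\<close> is the assumed bound for the
  second eigenvalue. As the all-ones vector spans the top eigenspace, every function \<open>f\<close>
  on the vertices satisfies \<open>v (\<langle>f, A f\<rangle> - \<beta> \<bar>f\<bar>\<^sup>2) \<le>
  \<kappa> (\<Sum>f)\<^sup>2\<close>. We use functions of the distance to a fixed vertex, as in
  Nilli's proof of the Alon--Boppana theorem. The Laplacian form of such a function only sees the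
  adjacencies between consecutive spheres, and the outward degree is at most \<open>q\<close>. The
  weights \<open>1, 1, 1/sqrt q, 1/q, \<dots>\<close> on the ball of radius \<open>l\<close>, with
  \<open>S = 1 + sqrt q + \<dots> + (sqrt q) ^ (l - 1)\<close>, give \<open>v \<le> (1 + k
  S)\<^sup>2\<close>, because \<open>\<kappa> = (sqrt q - 1)\<^sup>2 + (2 sqrt q - 1)/l\<close>. This
  is smaller than the claimed bound for \<open>l \<ge> 2\<close>, except for cubic graphs with
  \<open>l \<le> 3\<close>, where other weights work. For \<open>l = 1\<close> the best radial
  function on the unit ball gives \<open>v \<le> 1 + k + k u\<close>, and \<open>u \<le> q\<close>
  with equality only for \<open>r = 3\<close>, \<open>u = 2\<close>.
\<close>

section \<open>Rayleigh quotients and the second eigenvalue\<close>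

text \<open>By compactness the Rayleigh quotient attains its maximum on the sum-zero functions.
  Symmetry and constant row sums make this space invariant, so the maximiser can be varied along its
  own residual, which must then vanish.\<close>

lemma rayleigh_maximiser:
  fixes a :: "'a \<Rightarrow> 'a \<Rightarrow> real"
  assumes fin: "finite V"
    and sym: "\<And>x y. a x y = a y x"
    and row: "\<And>x. x \<in> V \<Longrightarrow> (\<Sum>y\<in>V. a x y) = k"
    and f0: "(\<Sum>x\<in>V. f x) = 0"
    and f: "(\<Sum>x\<in>V. \<Sum>y\<in>V. a x y * f x * f y) > b * (\<Sum>x\<in>V. (f x)\<^sup>2)"
  shows "\<exists>\<rho> g. \<rho> > b \<and> (\<Sum>x\<in>V. g x) = 0 \<and> (\<exists>x\<in>V. g x \<noteq> 0) \<and>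
           (\<forall>x\<in>V. (\<Sum>y\<in>V. a x y * g y) = \<rho> * g x)"
proof -
  define F where "F g = (\<Sum>x\<in>V. \<Sum>y\<in>V. a x y * g x * g y)" for g
  define nm where "nm g = (\<Sum>x\<in>V. (g x)\<^sup>2)" for g :: "'a \<Rightarrow> real"
  \<comment> \<open>Prescribing the value 0 off \<open>V\<close> puts \<open>S\<close> inside the
    product \<open>K\<close> of compact sets, which is compact by Tychonoff's theorem even over an
    infinite type.\<close>
  define S where "S = {g. (\<forall>x. x \<notin> V \<longrightarrow> g x = 0) \<and> (\<Sum>x\<in>V. g x) = 0 \<and> nm g = 1}"
  define K :: "('a \<Rightarrow> real) set" where "K = PiE UNIV (\<lambda>x. if x \<in> V then {-1..1} else {0})"
  have K: "compact K"
    unfolding K_def compactin_euclidean_iff[symmetric] euclidean_product_topology[symmetric]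
    by (subst compactin_PiE) (auto simp: compactin_euclidean_iff)
  have "closed {g. (\<Sum>x\<in>V. g x) = (0::real)}" "closed {g. nm g = 1}"
    unfolding nm_def by (intro closed_Collect_eq continuous_intros continuous_on_product_coordinates)+
  then have "compact (K \<inter> ({g. (\<Sum>x\<in>V. g x) = 0} \<inter> {g. nm g = 1}))"
    using K by (intro compact_Int_closed closed_Int)
  moreover have "K \<inter> ({g. (\<Sum>x\<in>V. g x) = 0} \<inter> {g. nm g = 1}) = S"
  proof -
    have "\<bar>g x\<bar> \<le> 1" if "nm g = 1" "x \<in> V" for g x
    proof -
      have "(g x)\<^sup>2 \<le> nm g"
        unfolding nm_def by (rule member_le_sum) (use that fin in auto)
      then show ?thesis using that(1) by (simp add: abs_square_le_1)
    qed
    then have "S \<subseteq> K" by (fastforce simp: S_def K_def PiE_def Pi_def abs_le_iff)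
    moreover have "g x = 0" if "g \<in> K" "x \<notin> V" for g x
    proof -
      have "g x \<in> (if x \<in> V then {-1..1} else {0})"
        using that(1) unfolding K_def by (rule PiE_mem) simp
      then show ?thesis using that(2) by simp
    qed
    ultimately show ?thesis by (auto simp: S_def)
  qed
  ultimately have S: "compact S" by simp
  define h where "h x = (if x \<in> V then f x / sqrt (nm f) else 0)" for x
  have "nm f \<noteq> 0"
  proof
    assume n: "nm f = 0"
    then have "\<forall>x\<in>V. f x = 0" unfolding nm_def using fin by (subst (asm) sum_nonneg_eq_0_iff) auto
    then show False using f n by (simp add: nm_def)
  qed
  then have nmf: "nm f > 0" unfolding nm_def by (simp add: less_le sum_nonneg)
  have "nm h = 1"
    using nmf by (simp add: nm_def h_def power_divide flip: sum_divide_distrib)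
  moreover have "(\<Sum>x\<in>V. h x) = 0" using f0 by (simp add: h_def flip: sum_divide_distrib)
  ultimately have hS: "h \<in> S" by (simp add: S_def h_def)
  have "F h = F f / nm f"
    unfolding F_def h_def using nmf by (simp add: sum_divide_distrib)
  moreover have "b * nm f < F f" using f by (simp only: F_def nm_def)
  ultimately have Fh: "F h > b" using nmf by (simp add: pos_less_divide_eq)
  have "continuous_on S F"
    unfolding F_def by (intro continuous_intros continuous_on_subset[OF continuous_on_product_coordinates]) auto
  then obtain g where g: "g \<in> S" "\<And>g'. g' \<in> S \<Longrightarrow> F g' \<le> F g"
    using continuous_attains_sup[OF S] hS by blast
  define \<rho> where "\<rho> = F g"
  have rb: "\<rho> > b" using g(2)[OF hS] Fh by (simp add: \<rho>_def)
  have gs: "(\<Sum>x\<in>V. g x) = 0" and gn: "nm g = 1" using g by (auto simp: S_def)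
  have max: "F z \<le> \<rho> * nm z" if z: "(\<Sum>x\<in>V. z x) = 0" for z
  proof (cases "nm z = 0")
    case True
    then have "\<forall>x\<in>V. z x = 0" unfolding nm_def using fin by (subst (asm) sum_nonneg_eq_0_iff) auto
    then show ?thesis by (simp add: F_def nm_def)
  next
    case False
    then have nz: "nm z > 0" unfolding nm_def by (simp add: less_le sum_nonneg)
    define z' where "z' x = (if x \<in> V then z x / sqrt (nm z) else 0)" for x
    have "nm z' = 1"
      using nz by (simp add: nm_def z'_def power_divide flip: sum_divide_distrib)
    moreover have "(\<Sum>x\<in>V. z' x) = 0" using z by (simp add: z'_def flip: sum_divide_distrib)
    ultimately have "z' \<in> S" by (simp add: S_def z'_def)
    then have "F z' \<le> \<rho>" using g(2) by (simp add: \<rho>_def)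
    moreover have "F z' = F z / nm z"
      unfolding F_def z'_def using nz by (simp add: sum_divide_distrib)
    ultimately show ?thesis using nz by (simp add: field_simps)
  qed
  \<comment> \<open>The residual of \<open>g\<close> as an eigenfunction for \<open>\<rho>\<close>.
    It sums to zero, so \<open>g + t z\<close> is an admissible variation for every
    \<open>t\<close>.\<close>
  define z where "z x = (\<Sum>y\<in>V. a x y * g y) - \<rho> * g x" for x
  have z0: "(\<Sum>x\<in>V. z x) = 0"
  proof -
    have "(\<Sum>x\<in>V. \<Sum>y\<in>V. a x y * g y) = (\<Sum>y\<in>V. (\<Sum>x\<in>V. a y x) * g y)"
      by (subst sum.swap) (simp add: sum_distrib_right sym)
    also have "\<dots> = k * (\<Sum>y\<in>V. g y)" by (simp add: row sum_distrib_left)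
    finally show ?thesis using gs by (simp add: z_def sum_subtractf flip: sum_distrib_left)
  qed
  define D where "D = F z - \<rho> * nm z"
  \<comment> \<open>The constant term vanishes since \<open>F g = \<rho>\<close> and
    \<open>nm g = 1\<close>. As the expression is never positive, its linear coefficient
    \<open>2 * nm z\<close> must be 0.\<close>
  have exp: "F (\<lambda>x. g x + t * z x) - \<rho> * nm (\<lambda>x. g x + t * z x) = 2 * t * nm z + t\<^sup>2 * D" for t
  proof -
    have 1: "F (\<lambda>x. g x + t * z x) = F g + 2 * t * (\<Sum>x\<in>V. \<Sum>y\<in>V. a x y * g y * z x) + t\<^sup>2 * F z"
    proof -
      have sw: "(\<Sum>x\<in>V. \<Sum>y\<in>V. a x y * g x * z y) = (\<Sum>x\<in>V. \<Sum>y\<in>V. a x y * g y * z x)"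
        by (subst sum.swap) (simp add: sym)
      have "F (\<lambda>x. g x + t * z x) = F g + t * (\<Sum>x\<in>V. \<Sum>y\<in>V. a x y * g y * z x)
          + t * (\<Sum>x\<in>V. \<Sum>y\<in>V. a x y * g x * z y) + t\<^sup>2 * F z"
        unfolding F_def
        by (simp add: sum_distrib_left sum.distrib[symmetric] algebra_simps power2_eq_square)
      then show ?thesis by (simp add: sw)
    qed
    have 2: "nm (\<lambda>x. g x + t * z x) = nm g + 2 * t * (\<Sum>x\<in>V. g x * z x) + t\<^sup>2 * nm z"
      unfolding nm_def
      by (simp add: sum_distrib_left sum.distrib[symmetric] algebra_simps power2_eq_square)
    have 3: "nm z = (\<Sum>x\<in>V. \<Sum>y\<in>V. a x y * g y * z x) - \<rho> * (\<Sum>x\<in>V. g x * z x)"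
    proof -
      have "(z x)\<^sup>2 = (\<Sum>y\<in>V. a x y * g y * z x) - \<rho> * (g x * z x)" for x
      proof -
        have "(z x)\<^sup>2 = ((\<Sum>y\<in>V. a x y * g y) - \<rho> * g x) * z x"
          by (simp add: z_def power2_eq_square)
        then show ?thesis by (simp add: left_diff_distrib sum_distrib_right mult.assoc)
      qed
      then show ?thesis by (simp add: nm_def sum_subtractf sum_distrib_left)
    qed
    have "F g + 2 * t * I + t\<^sup>2 * F z - \<rho> * (nm g + 2 * t * J + t\<^sup>2 * nm z) =
        2 * t * nm z + t\<^sup>2 * D" if "nm z = I - \<rho> * J" for I J
    proof -
      have I: "I = nm z + \<rho> * J" using that by simp
      show ?thesis using gn unfolding I by (simp add: \<rho>_def D_def algebra_simps)
    qed
    from this[OF 3] show ?thesis unfolding 1 2 .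
  qed
  have le: "2 * t * nm z + t\<^sup>2 * D \<le> 0" for t
  proof -
    have "(\<Sum>x\<in>V. g x + t * z x) = 0" using gs z0 by (simp add: sum.distrib flip: sum_distrib_left)
    from max[OF this] show ?thesis using exp[of t] by simp
  qed
  have "nm z \<le> 0"
  proof (rule ccontr)
    assume "\<not> nm z \<le> 0"
    then have n: "nm z > 0" by simp
    \<comment> \<open>So small that \<open>t\<^sup>2 * \<bar>D\<bar>\<close> is at most
      \<open>t * nm z\<close>, half of the linear term.\<close>
    define t where "t = nm z / (\<bar>D\<bar> + 1)"
    have t: "t > 0" using n by (simp add: t_def)
    have "t * \<bar>D\<bar> \<le> nm z" using n by (simp add: t_def field_simps)
    then have "t * (t * \<bar>D\<bar>) \<le> t * nm z" using t by (intro mult_left_mono) auto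
    moreover have "t * (t * (- \<bar>D\<bar>)) \<le> t * (t * D)" using t by (intro mult_left_mono) auto
    moreover have "t * nm z > 0" using n t by simp
    ultimately show False using le[of t] by (simp add: power2_eq_square algebra_simps)
  qed
  then have "nm z = 0" unfolding nm_def by (simp add: antisym sum_nonneg)
  then have "\<forall>x\<in>V. z x = 0" unfolding nm_def using fin by (subst (asm) sum_nonneg_eq_0_iff) auto
  moreover have "\<exists>x\<in>V. g x \<noteq> 0"
  proof (rule ccontr)
    assume "\<not> ?thesis"
    then have "nm g = 0" by (simp add: nm_def)
    then show False using gn by simp
  qed
  ultimately show ?thesis using rb gs by (auto simp: z_def)
qed

text \<open>If the last but one entry of the ascending list were at most \<open>b\<close>, only the
  last position could exceed \<open>b\<close>; but \<open>x\<close> and \<open>y\<close> occupy two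
  positions.\<close>

lemma second_largest_gt:
  fixes M :: "'b :: linorder multiset"
  assumes "x \<in># M" "y \<in># M" "x \<noteq> y" "b < x" "b < y"
  shows "b < rev (sorted_list_of_multiset M) ! 1"
proof (rule ccontr)
  define xs where "xs = sorted_list_of_multiset M"
  define n where "n = length xs"
  have xs: "sorted xs" "x \<in> set xs" "y \<in> set xs" using assms by (auto simp: xs_def)
  then obtain i j where ij: "i < n" "j < n" "xs ! i = x" "xs ! j = y"
    by (auto simp: in_set_conv_nth n_def)
  with assms have "i \<noteq> j" by auto
  with ij have n2: "n \<ge> 2" by auto
  then have r: "rev xs ! 1 = xs ! (n - 2)" by (simp add: rev_nth n_def numeral_2_eq_2)
  assume "\<not> b < rev (sorted_list_of_multiset M) ! 1"
  then have b: "xs ! (n - 2) \<le> b" using r by (simp add: xs_def not_less)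
  have "m = n - 1" if "m < n" "b < xs ! m" for m
  proof (rule ccontr)
    assume "m \<noteq> n - 1"
    then have "m \<le> n - 2" using that by simp
    then have "xs ! m \<le> xs ! (n - 2)" using xs(1) n2 by (intro sorted_nth_mono) (auto simp: n_def)
    then show False using that b by auto
  qed
  then show False using ij assms \<open>i \<noteq> j\<close> by metis
qed

text \<open>The last but one entry of the ascending list can exceed \<open>b\<close> only if it and
  the last one both equal \<open>c\<close>, against the bound on the multiplicity of
  \<open>c\<close>.\<close>

lemma second_largest_le:
  fixes M :: "'b :: linorder multiset"
  assumes M: "size M \<ge> 2" "count M c \<le> 1" and b: "\<And>x. x \<in># M \<Longrightarrow> x = c \<or> x \<le> b"
  shows "rev (sorted_list_of_multiset M) ! 1 \<le> b"
proof (rule ccontr)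
  define xs where "xs = sorted_list_of_multiset M"
  define n where "n = length xs"
  have xs: "sorted xs" "mset xs = M" by (auto simp: xs_def)
  have n2: "n \<ge> 2" using M xs by (metis n_def size_mset)
  then have r: "rev xs ! 1 = xs ! (n - 2)" by (simp add: rev_nth n_def numeral_2_eq_2)
  assume "\<not> rev (sorted_list_of_multiset M) ! 1 \<le> b"
  then have gt: "b < xs ! (n - 2)" using r by (simp add: xs_def not_le)
  moreover have "xs ! (n - 2) \<le> xs ! (n - 1)"
    using xs(1) n2 by (intro sorted_nth_mono) (auto simp: n_def)
  moreover have "xs ! (n - 2) \<in># M" "xs ! (n - 1) \<in># M"
    using n2 xs(2) by (auto simp: n_def)
  ultimately have eq: "xs ! (n - 2) = c" "xs ! (n - 1) = c" using b by (meson leD less_le_trans)+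
  have "card {n - 2, n - 1} \<le> card {i. i < length xs \<and> c = xs ! i}"
    using n2 eq by (intro card_mono) (auto simp: n_def)
  also have "\<dots> = count M c"
    by (simp flip: xs(2) add: count_mset count_list_eq_length_filter length_filter_conv_card)
  finally show False using M n2 by (simp add: numeral_2_eq_2 split: if_splits)
qed

section \<open>The adjacency matrix as an operator on functions on the vertices\<close>

definition adj :: "'a set set \<Rightarrow> 'a \<Rightarrow> 'a \<Rightarrow> real" where
  "adj E x y = (if x = y then 0 else real (card {e\<in>E. {x, y} \<subseteq> e}))"

lemma adj_sym: "adj E x y = adj E y x"
  by (simp add: adj_def insert_commute)

lemma adj_nonneg: "adj E x y \<ge> 0"
  by (simp add: adj_def)

lemma adjacency_matrix_carrier: "adjacency_matrix vs E \<in> carrier_mat (length vs) (length vs)"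
  by (simp add: adjacency_matrix_def)

lemma adjacency_matrix_mult_vec:
  assumes "distinct vs" "i < length vs"
  shows "(adjacency_matrix vs E *\<^sub>v vec (length vs) (\<lambda>j. f (vs ! j))) $ i =
    (\<Sum>y\<in>set vs. adj E (vs ! i) y * f y)"
proof -
  have "(adjacency_matrix vs E *\<^sub>v vec (length vs) (\<lambda>j. f (vs ! j))) $ i =
      (\<Sum>j<length vs. adj E (vs ! i) (vs ! j) * f (vs ! j))"
    using assms
    by (auto simp: adjacency_matrix_def scalar_prod_def adj_def nth_eq_iff_index_eq lessThan_atLeast0
        intro!: sum.cong)
  also have "\<dots> = (\<Sum>y\<in>set vs. adj E (vs ! i) y * f y)"
    by (rule sum.reindex_bij_betw[OF bij_betw_nth]) (use assms in auto)
  finally show ?thesis .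
qed

lemma adjacency_matrix_eigenvector_function:
  assumes vs: "distinct vs" "set vs = V"
    and v: "v \<in> carrier_vec (length vs)" "adjacency_matrix vs E *\<^sub>v v = c \<cdot>\<^sub>v v"
  obtains f where "\<And>i. i < length vs \<Longrightarrow> f (vs ! i) = v $ i"
    "\<And>x. x \<in> V \<Longrightarrow> (\<Sum>y\<in>V. adj E x y * f y) = c * f x"
proof -
  let ?A = "adjacency_matrix vs E" and ?n = "length vs"
  define f where "f x = v $ (the_inv_into {..<?n} (\<lambda>i. vs ! i) x)" for x
  have inj: "inj_on (\<lambda>i. vs ! i) {..<?n}" using vs(1) by (simp add: inj_on_nth)
  have fv: "f (vs ! i) = v $ i" if "i < ?n" for i
    unfolding f_def using the_inv_into_f_f[OF inj] that by simp
  have veq: "v = vec ?n (\<lambda>j. f (vs ! j))" using v(1) by (intro eq_vecI) (auto simp: fv)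
  have "(\<Sum>y\<in>V. adj E x y * f y) = c * f x" if x: "x \<in> V" for x
  proof -
    obtain i where i: "i < ?n" "x = vs ! i"
      using x unfolding vs(2)[symmetric] in_set_conv_nth by blast
    have "(\<Sum>y\<in>V. adj E x y * f y) = (\<Sum>y\<in>set vs. adj E (vs ! i) y * f y)"
      using i vs(2) by simp
    also have "\<dots> = (?A *\<^sub>v vec ?n (\<lambda>j. f (vs ! j))) $ i"
      by (rule adjacency_matrix_mult_vec[OF vs(1) i(1), symmetric])
    also have "\<dots> = (c \<cdot>\<^sub>v v) $ i" by (simp only: veq[symmetric] v(2))
    also have "\<dots> = c * f x" using v(1) i fv by simp
    finally show ?thesis .
  qed
  with fv show ?thesis by (rule that)
qed

lemma char_poly_adjacency_matrix_root_iff: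
  assumes "distinct vs" "set vs = V"
  shows "poly (char_poly (adjacency_matrix vs E)) c = 0 \<longleftrightarrow>
    (\<exists>f. (\<exists>x\<in>V. f x \<noteq> 0) \<and> (\<forall>x\<in>V. (\<Sum>y\<in>V. adj E x y * f y) = c * f x))"
proof -
  let ?A = "adjacency_matrix vs E" and ?n = "length vs"
  have dr: "dim_row ?A = ?n" by (simp add: adjacency_matrix_def)
  have "eigenvalue ?A c \<longleftrightarrow>
    (\<exists>f. (\<exists>x\<in>V. f x \<noteq> 0) \<and> (\<forall>x\<in>V. (\<Sum>y\<in>V. adj E x y * f y) = c * f x))"
  proof
    assume "eigenvalue ?A c"
    then obtain v where v: "v \<in> carrier_vec ?n" "v \<noteq> 0\<^sub>v ?n" "?A *\<^sub>v v = c \<cdot>\<^sub>v v"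
      by (auto simp: eigenvalue_def eigenvector_def dr)
    obtain f where f: "\<And>i. i < ?n \<Longrightarrow> f (vs ! i) = v $ i"
      "\<And>x. x \<in> V \<Longrightarrow> (\<Sum>y\<in>V. adj E x y * f y) = c * f x"
      by (rule adjacency_matrix_eigenvector_function[OF assms v(1,3)]) (rule that)
    have "\<exists>i<?n. v $ i \<noteq> 0"
    proof (rule ccontr)
      assume "\<not> ?thesis"
      then have "v = 0\<^sub>v ?n" using v(1) by (intro eq_vecI) auto
      then show False using v(2) by simp
    qed
    then obtain j where j: "j < ?n" "f (vs ! j) \<noteq> 0" using f(1) by auto
    then have "vs ! j \<in> V" using assms(2) nth_mem by blast
    with j f(2) show "\<exists>f. (\<exists>x\<in>V. f x \<noteq> 0) \<and> (\<forall>x\<in>V. (\<Sum>y\<in>V. adj E x y * f y) = c * f x)"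
      by blast
  next
    assume "\<exists>f. (\<exists>x\<in>V. f x \<noteq> 0) \<and> (\<forall>x\<in>V. (\<Sum>y\<in>V. adj E x y * f y) = c * f x)"
    then obtain f where f: "\<exists>x\<in>V. f x \<noteq> 0" "\<And>x. x \<in> V \<Longrightarrow> (\<Sum>y\<in>V. adj E x y * f y) = c * f x"
      by blast
    let ?v = "vec ?n (\<lambda>j. f (vs ! j))"
    have "?v \<noteq> 0\<^sub>v ?n"

    proof
      assume z: "?v = 0\<^sub>v ?n"
      have "f (vs ! i) = 0" if "i < ?n" for i
        using arg_cong[OF z, of "\<lambda>v. v $ i"] that by simp
      then show False using f(1) assms(2) by (auto simp: in_set_conv_nth)
    qed
    moreover have "?A *\<^sub>v ?v = c \<cdot>\<^sub>v ?v"
    proof (rule eq_vecI)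
      fix i assume "i < dim_vec (c \<cdot>\<^sub>v ?v)"
      then have i: "i < ?n" by simp
      then have "vs ! i \<in> V" using assms(2) nth_mem by blast
      then show "(?A *\<^sub>v ?v) $ i = (c \<cdot>\<^sub>v ?v) $ i"
        unfolding adjacency_matrix_mult_vec[OF assms(1) i] assms(2) using f(2) i by simp
    qed (simp add: dr)
    ultimately have "eigenvector ?A ?v c" by (simp add: eigenvector_def dr)
    then show "eigenvalue ?A c" unfolding eigenvalue_def by blast
  qed
  then show ?thesis using eigenvalue_root_char_poly[OF adjacency_matrix_carrier] by blast
qed

lemma eigenvalues_hg_obtain:
  assumes "finite V"
  obtains vs where "distinct vs" "set vs = V"
    "eigenvalues_hg V E = proots (char_poly (adjacency_matrix vs E))"
proof -
  define vs where "vs = (SOME vs. distinct vs \<and> set vs = V)"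
  have "distinct vs \<and> set vs = V"
    unfolding vs_def by (rule someI_ex) (use finite_distinct_list[OF assms] in blast)
  then show ?thesis using that by (auto simp: eigenvalues_hg_def vs_def)
qed

lemma char_poly_nonzero:
  fixes A :: "'b :: idom mat"
  assumes "A \<in> carrier_mat n n"
  shows "char_poly A \<noteq> 0"
  using degree_monic_char_poly[OF assms] by auto

text \<open>The interface between the spectrum and functions on \<open>V\<close>: from here on the
  enumeration of the vertices and the characteristic polynomial matter only when multiplicities are
  counted.\<close>

lemma mem_eigenvalues_hg_iff:
  assumes "finite V"
  shows "c \<in># eigenvalues_hg V E \<longleftrightarrow>
    (\<exists>f. (\<exists>x\<in>V. f x \<noteq> 0) \<and> (\<forall>x\<in>V. (\<Sum>y\<in>V. adj E x y * f y) = c * f x))"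
proof -
  obtain vs where vs: "distinct vs" "set vs = V"
    "eigenvalues_hg V E = proots (char_poly (adjacency_matrix vs E))"
    using eigenvalues_hg_obtain[OF assms] .
  have "set_mset (proots (char_poly (adjacency_matrix vs E))) =
      {c. poly (char_poly (adjacency_matrix vs E)) c = 0}"
    by (rule set_count_proots[OF char_poly_nonzero[OF adjacency_matrix_carrier]])
  then have "c \<in># eigenvalues_hg V E \<longleftrightarrow> poly (char_poly (adjacency_matrix vs E)) c = 0"
    unfolding vs(3) by blast
  then show ?thesis unfolding char_poly_adjacency_matrix_root_iff[OF vs(1,2)] .
qed

section \<open>Radial test functions\<close>

text \<open>The left side depends only on differences of \<open>f\<close>. It is therefore unchanged
  when a constant is subtracted, and for a radial function it ignores adjacent pairs at equal
  distance from the centre.\<close>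

lemma laplacian_form:
  fixes a :: "'a \<Rightarrow> 'a \<Rightarrow> real"
  assumes sym: "\<And>x y. a x y = a y x"
    and row: "\<And>x. x \<in> V \<Longrightarrow> (\<Sum>y\<in>V. a x y) = k"
  shows "(\<Sum>x\<in>V. \<Sum>y\<in>V. a x y * (f x - f y)\<^sup>2) =
    2 * (k * (\<Sum>x\<in>V. (f x)\<^sup>2) - (\<Sum>x\<in>V. \<Sum>y\<in>V. a x y * f x * f y))"
proof -
  have 1: "(\<Sum>x\<in>V. \<Sum>y\<in>V. a x y * (f x)\<^sup>2) = k * (\<Sum>x\<in>V. (f x)\<^sup>2)"
    by (simp add: row sum_distrib_left flip: sum_distrib_right)
  have 2: "(\<Sum>x\<in>V. \<Sum>y\<in>V. a x y * (f y)\<^sup>2) = k * (\<Sum>x\<in>V. (f x)\<^sup>2)"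
    by (subst sum.swap) (simp add: 1[symmetric] sym)
  have "(\<Sum>x\<in>V. \<Sum>y\<in>V. a x y * (f x - f y)\<^sup>2) =
      (\<Sum>x\<in>V. \<Sum>y\<in>V. a x y * (f x)\<^sup>2) + (\<Sum>x\<in>V. \<Sum>y\<in>V. a x y * (f y)\<^sup>2)
      - 2 * (\<Sum>x\<in>V. \<Sum>y\<in>V. a x y * f x * f y)"
    by (simp add: sum_distrib_left sum.distrib[symmetric] sum_subtractf[symmetric]
        power2_eq_square algebra_simps)
  then show ?thesis unfolding 1 2 by simp
qed

text \<open>Here \<open>n i\<close> is the size of the sphere of radius \<open>i\<close> around a vertex, \<open>w\<close> is a radial test
  function supported in the ball of radius \<open>d\<close>, and \<open>\<kappa>\<close> is \<open>k\<close> minus a bound for the second eigenvalue.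
  The centre has \<open>k\<close> neighbours, every other vertex at most \<open>q\<close> further outwards.\<close>

definition sphere_tests :: "real \<Rightarrow> nat \<Rightarrow> nat \<Rightarrow> real \<Rightarrow> bool" where
  "sphere_tests v k q \<kappa> \<longleftrightarrow>
     (\<exists>n :: nat \<Rightarrow> nat. n 0 = 1 \<and> n 1 \<le> k \<and> (\<forall>i. n (Suc (Suc i)) \<le> q * n (Suc i)) \<and>
       (\<forall>(w :: nat \<Rightarrow> real) d. (\<forall>i>d. w i = 0) \<longrightarrow>
         v * (\<Sum>i\<le>d. n i * (\<kappa> * (w i)\<^sup>2 - real (if i = 0 then k else q) * (w i - w (Suc i))\<^sup>2))
         \<le> \<kappa> * (\<Sum>i\<le>d. n i * w i)\<^sup>2))"

section \<open>Spectral bounds and distance spheres in regular uniform hypergraphs\<close>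

locale regular_uniform_hg =
  fixes V :: "'a set" and E r u
  assumes hg: "hypergraph V E" and conn: "connected_hg V E"
    and reg: "regular_hg r V E" and unif: "uniform_hg u E"
begin

lemma finite_V: "finite V"
  using hg by (simp add: hypergraph_def)

lemma finite_E: "finite E"
  by (rule finite_subset[OF _ finite_Pow_iff[THEN iffD2, OF finite_V]])
     (use hg in \<open>auto simp: hypergraph_def\<close>)

lemma edge_subset: "e \<in> E \<Longrightarrow> e \<subseteq> V"
  using hg by (simp add: hypergraph_def)

lemma finite_edge: "e \<in> E \<Longrightarrow> finite e"
  using edge_subset finite_V finite_subset by blast

lemma card_edge: "e \<in> E \<Longrightarrow> card e = u"
  using unif by (simp add: uniform_hg_def)

lemma degree: "x \<in> V \<Longrightarrow> card {e\<in>E. x \<in> e} = r"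
  using reg by (simp add: regular_hg_def)

text \<open>For \<open>y\<close> other than \<open>x\<close>, \<open>adj E x y\<close> is the number
  of edges at \<open>x\<close> containing \<open>y\<close>, so the order of summation can be
  exchanged. Degree counts then reduce to counts inside single edges.\<close>

lemma sum_adj: "(\<Sum>y\<in>V. adj E x y * g y) = (\<Sum>e\<in>{e\<in>E. x \<in> e}. \<Sum>y\<in>e - {x}. g y)"
proof -
  have adj: "adj E x y = (\<Sum>e\<in>{e\<in>E. x \<in> e}. if y \<in> e - {x} then 1 else 0)" for y
  proof (cases "y = x")
    case False
    have "{e\<in>E. {x, y} \<subseteq> e} = {e \<in> {e\<in>E. x \<in> e}. y \<in> e}" by auto
    then show ?thesis using False finite_E
      by (simp add: adj_def sum.If_cases Int_def)
  qed (simp add: adj_def)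
  have "(\<Sum>y\<in>V. adj E x y * g y) =
      (\<Sum>e\<in>{e\<in>E. x \<in> e}. \<Sum>y\<in>V. if y \<in> e - {x} then g y else 0)"
    unfolding adj sum_distrib_right by (subst sum.swap) (intro sum.cong, auto)
  also have "\<dots> = (\<Sum>e\<in>{e\<in>E. x \<in> e}. \<Sum>y\<in>e - {x}. g y)"
  proof (rule sum.cong[OF refl])
    fix e assume "e \<in> {e\<in>E. x \<in> e}"
    then have "V \<inter> (e - {x}) = e - {x}" using edge_subset by auto
    then show "(\<Sum>y\<in>V. if y \<in> e - {x} then g y else 0) = (\<Sum>y\<in>e - {x}. g y)"
      using sum.inter_restrict[OF finite_V, of g "e - {x}"] by simp
  qed
  finally show ?thesis .
qed

lemma row_sum: "x \<in> V \<Longrightarrow> (\<Sum>y\<in>V. adj E x y) = real (r * (u - 1))"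
  using sum_adj[of x "\<lambda>_. 1"] by (simp add: finite_edge card_edge degree)

lemma adj_pos: "e \<in> E \<Longrightarrow> x \<in> e \<Longrightarrow> y \<in> e \<Longrightarrow> x \<noteq> y \<Longrightarrow> adj E x y \<ge> 1"
proof -
  assume a: "e \<in> E" "x \<in> e" "y \<in> e" "x \<noteq> y"
  then have "card {e\<in>E. {x, y} \<subseteq> e} > 0" using finite_E by (subst card_gt_0_iff) auto
  then show ?thesis using a(4) by (simp add: adj_def)
qed

lemma connected_induct:
  assumes "x \<in> V" "y \<in> V" "P x"
    and step: "\<And>a b e. e \<in> E \<Longrightarrow> a \<in> e \<Longrightarrow> b \<in> e \<Longrightarrow> P a \<Longrightarrow> P b"
  shows "P y"
proof -
  obtain xs es where w: "walk_hg V E xs es" "hd xs = x" "last xs = y"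
    using conn assms(1,2) unfolding connected_hg_def by blast
  have "P (xs ! i)" if "i \<le> length es" for i
    using that
  proof (induction i)
    case 0
    then show ?case using w assms(3) by (cases xs) (auto simp: walk_hg_def)
  next
    case (Suc i)
    then have "es ! i \<in> E" "xs ! i \<in> es ! i" "xs ! Suc i \<in> es ! i"
      using w(1) by (auto simp: walk_hg_def)
    moreover have "P (xs ! i)" using Suc by simp
    ultimately show ?case by (rule step)
  qed
  then have "P (xs ! length es)" by simp
  moreover have "xs \<noteq> []" "length xs - 1 = length es" using w(1) by (auto simp: walk_hg_def)
  ultimately have "P (last xs)" by (simp add: last_conv_nth)
  then show ?thesis by (simp only: w)
qed

text \<open>The Laplacian form of such a \<open>g\<close> is zero. All its terms are nonnegative, so
  \<open>g\<close> agrees on adjacent vertices, and connectedness spreads this over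
  \<open>V\<close>.\<close>

lemma top_eigenvector_constant:
  assumes "\<And>x. x \<in> V \<Longrightarrow> (\<Sum>y\<in>V. adj E x y * g y) = real (r * (u - 1)) * g x"
    and "x \<in> V" "y \<in> V"
  shows "g y = g x"
proof -
  have "(\<Sum>x\<in>V. \<Sum>y\<in>V. adj E x y * (g x - g y)\<^sup>2) = 0"
  proof -
    have "(\<Sum>x\<in>V. \<Sum>y\<in>V. adj E x y * g x * g y) = (\<Sum>x\<in>V. g x * (\<Sum>y\<in>V. adj E x y * g y))"
      by (simp add: sum_distrib_left mult_ac)
    also have "\<dots> = (\<Sum>x\<in>V. g x * (real (r * (u - 1)) * g x))"
      by (rule sum.cong) (simp_all only: assms(1))
    also have "\<dots> = real (r * (u - 1)) * (\<Sum>x\<in>V. (g x)\<^sup>2)"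
      by (simp add: sum_distrib_left power2_eq_square mult_ac)
    finally show ?thesis
      by (subst laplacian_form[OF adj_sym row_sum]) auto
  qed
  then have z: "adj E x y * (g x - g y)\<^sup>2 = 0" if "x \<in> V" "y \<in> V" for x y
    using that finite_V
    by (subst (asm) sum_nonneg_eq_0_iff; (subst (asm) sum_nonneg_eq_0_iff)?)
       (auto intro!: sum_nonneg mult_nonneg_nonneg adj_nonneg simp: sum_nonneg_eq_0_iff adj_nonneg)
  show ?thesis
    using assms(2,3)
  proof (rule connected_induct)
    fix a b e assume e: "e \<in> E" "a \<in> e" "b \<in> e" "g a = g x"
    then have "a \<in> V" "b \<in> V" using edge_subset by auto
    then show "g b = g x" using z[of a b] adj_pos[of e a b] e by (cases "a = b") auto
  qed simp
qed

text \<open>A violating \<open>f\<close> yields an eigenvalue above \<open>b\<close> with a sum-zero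
  eigenfunction. It differs from \<open>r * (u - 1)\<close>, whose eigenfunctions are constant, so
  two distinct eigenvalues exceed \<open>b\<close>.\<close>

lemma rayleigh_bound:
  fixes f :: "'a \<Rightarrow> real" and b :: real
  assumes b: "second_eigenvalue V E \<le> b" "b < real (r * (u - 1))"
    and f: "(\<Sum>x\<in>V. f x) = 0"
  shows "(\<Sum>x\<in>V. \<Sum>y\<in>V. adj E x y * f x * f y) \<le> b * (\<Sum>x\<in>V. (f x)\<^sup>2)"
proof (rule ccontr)
  assume "\<not> ?thesis"
  then obtain \<rho> g where g: "\<rho> > b" "(\<Sum>x\<in>V. g x) = 0" "\<exists>x\<in>V. g x \<noteq> 0"
      "\<And>x. x \<in> V \<Longrightarrow> (\<Sum>y\<in>V. adj E x y * g y) = \<rho> * g x"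
    using rayleigh_maximiser[OF finite_V adj_sym row_sum f, of b] by (auto simp: not_le)
  let ?k = "real (r * (u - 1))"
  have "\<rho> \<noteq> ?k"
  proof
    assume eq: "\<rho> = ?k"
    obtain x where x: "x \<in> V" "g x \<noteq> 0" using g(3) by blast
    have "g y = g x" if "y \<in> V" for y
      using top_eigenvector_constant[of g x y] g(4) eq x(1) that by auto
    then have "(\<Sum>y\<in>V. g y) = card V * g x" by simp
    moreover have "card V \<noteq> 0" using x finite_V by auto
    ultimately show False using g(2) x(2) by simp
  qed
  moreover have "\<rho> \<in># eigenvalues_hg V E"
    unfolding mem_eigenvalues_hg_iff[OF finite_V] using g by blast
  moreover have "?k \<in># eigenvalues_hg V E"
    unfolding mem_eigenvalues_hg_iff[OF finite_V]
    by (rule exI[of _ "\<lambda>_. 1"]) (use g(3) row_sum in auto)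
  ultimately have "b < second_eigenvalue V E"
    unfolding second_eigenvalue_def using g(1) b(2) by (intro second_largest_gt)
  then show False using b(1) by simp
qed

text \<open>Apply \<open>rayleigh_bound\<close> to \<open>f\<close> minus its mean. This leaves the
  Laplacian form alone and lowers the squared norm by the square of the sum divided by
  \<open>card V\<close>.\<close>

lemma test_function_bound:
  fixes f :: "'a \<Rightarrow> real" and b :: real
  assumes b: "second_eigenvalue V E \<le> b" "b < real (r * (u - 1))"
  shows "card V * ((\<Sum>x\<in>V. \<Sum>y\<in>V. adj E x y * f x * f y) - b * (\<Sum>x\<in>V. (f x)\<^sup>2))
    \<le> (r * (u - 1) - b) * (\<Sum>x\<in>V. f x)\<^sup>2"
proof (cases "V = {}")
  case False
  let ?k = "real (r * (u - 1))"
  define v where "v = real (card V)"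
  have v: "v > 0" using False finite_V by (simp add: v_def card_gt_0_iff)
  define s where "s = (\<Sum>x\<in>V. f x)"
  define m where "m = s / v"
  define F where "F = (\<Sum>x\<in>V. \<Sum>y\<in>V. adj E x y * f x * f y)"
  define N where "N = (\<Sum>x\<in>V. (f x)\<^sup>2)"
  have mv: "m * v = s" using v by (simp add: m_def)
  have "(\<Sum>x\<in>V. f x - m) = 0" using mv by (simp add: sum_subtractf s_def v_def mult.commute)
  from rayleigh_bound[OF b this]
  have le: "(\<Sum>x\<in>V. \<Sum>y\<in>V. adj E x y * (f x - m) * (f y - m)) \<le> b * (\<Sum>x\<in>V. (f x - m)\<^sup>2)" .
  have 1: "(\<Sum>x\<in>V. (f x - m)\<^sup>2) = N - 2 * m * s + m\<^sup>2 * v"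
    by (simp add: N_def s_def v_def power2_diff sum.distrib sum_subtractf sum_distrib_left
        sum_distrib_right mult_ac)
  have l: "2 * (?k * (\<Sum>x\<in>V. (f x - m)\<^sup>2) - (\<Sum>x\<in>V. \<Sum>y\<in>V. adj E x y * (f x - m) * (f y - m)))
      = 2 * (?k * N - F)"
    unfolding N_def F_def
    by (subst (1 2) laplacian_form[OF adj_sym row_sum, symmetric]) simp_all
  have "F - b * N \<le> (k - b) * (2 * m * s - m\<^sup>2 * v)"
    if "2 * (k * S - T) = 2 * (k * N - F)" "T \<le> b * S" "S = N - 2 * m * s + m\<^sup>2 * v" for k S T
    using that by (simp add: algebra_simps)
  from this[OF l le 1] have "v * (F - b * N) \<le> v * ((?k - b) * (2 * m * s - m\<^sup>2 * v))"
    using v by (intro mult_left_mono) auto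
  also have "\<dots> = (?k - b) * (v * (2 * m * s - m\<^sup>2 * v))" by (rule mult.left_commute)
  also have "v * (2 * m * s - m\<^sup>2 * v) = s\<^sup>2"
    unfolding mv[symmetric] by (simp add: power2_eq_square algebra_simps)
  finally show ?thesis by (simp add: F_def N_def s_def v_def)
qed simp

lemma level_function:
  assumes x: "x \<in> V"
  obtains lev :: "'a \<Rightarrow> nat" where
    "\<And>z. z \<in> V \<Longrightarrow> lev z = 0 \<longleftrightarrow> z = x"
    "\<And>e y z. e \<in> E \<Longrightarrow> y \<in> e \<Longrightarrow> z \<in> e \<Longrightarrow> lev z \<le> Suc (lev y)"
    "\<And>z i. z \<in> V \<Longrightarrow> lev z = Suc i \<Longrightarrow> \<exists>e\<in>E. z \<in> e \<and> (\<exists>y\<in>e. lev y = i)"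
proof -
  define R where "R = {(y, z). \<exists>e\<in>E. y \<in> e \<and> z \<in> e}"
  \<comment> \<open>Chains in \<open>R\<close> may stay at a vertex, but the least exponent is still
    the distance from \<open>x\<close>.\<close>
  define lev where "lev z = (LEAST n. (x, z) \<in> R ^^ n)" for z
  have ex: "\<exists>n. (x, z) \<in> R ^^ n" if "z \<in> V" for z
    using x that
  proof (rule connected_induct)
    show "\<exists>n. (x, x) \<in> R ^^ n" by (rule exI[of _ 0]) simp
  next
    fix a b e assume "e \<in> E" "a \<in> e" "b \<in> e" "\<exists>n. (x, a) \<in> R ^^ n"
    then obtain n where "(x, a) \<in> R ^^ n" "(a, b) \<in> R" by (auto simp: R_def)
    then have "(x, b) \<in> R ^^ Suc n" by auto
    then show "\<exists>n. (x, b) \<in> R ^^ n" by blast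
  qed
  have in_lev: "(x, z) \<in> R ^^ lev z" if "z \<in> V" for z
    unfolding lev_def by (rule LeastI_ex[OF ex[OF that]])
  have lev_le: "lev z \<le> n" if "(x, z) \<in> R ^^ n" for z n
    unfolding lev_def using that by (rule Least_le)
  have 1: "lev z = 0 \<longleftrightarrow> z = x" if "z \<in> V" for z
    using in_lev[OF that] lev_le[of x 0] by auto
  have 2: "lev z \<le> Suc (lev y)" if "e \<in> E" "y \<in> e" "z \<in> e" for e y z
  proof -
    have "(x, y) \<in> R ^^ lev y" using in_lev edge_subset that by blast
    moreover have "(y, z) \<in> R" using that by (auto simp: R_def)
    ultimately show ?thesis by (intro lev_le) auto
  qed
  have 3: "\<exists>e\<in>E. z \<in> e \<and> (\<exists>y\<in>e. lev y = i)" if "z \<in> V" "lev z = Suc i" for z i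
  proof -
    have "(x, z) \<in> R ^^ Suc i" using in_lev[OF that(1)] that(2) by simp
    then obtain y e where y: "(x, y) \<in> R ^^ i" "e \<in> E" "y \<in> e" "z \<in> e" by (auto simp: R_def)
    then have "lev y \<le> i" "lev z \<le> Suc (lev y)" using lev_le 2 by auto
    then show ?thesis using y that(2) by (intro bexI[of _ e]) auto
  qed
  from 1 2 3 show ?thesis by (rule that)
qed

text \<open>The witness \<open>n i\<close> is the size of the sphere of radius \<open>i\<close>
  around \<open>x\<close>. Inserting a radial function into \<open>test_function_bound\<close> and
  rewriting by \<open>laplacian_form\<close> leaves only outward adjacencies, whose number at a
  vertex is bounded by \<open>Q\<close>.\<close>

lemma sphere_tests_card:
  fixes b :: real
  assumes b: "second_eigenvalue V E \<le> b" "b < real (r * (u - 1))" and x: "x \<in> V"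
  shows "sphere_tests (card V) (r * (u - 1)) ((r - 1) * (u - 1)) (r * (u - 1) - b)"
proof -
  obtain lev :: "'a \<Rightarrow> nat" where lev:
    "\<And>z. z \<in> V \<Longrightarrow> lev z = 0 \<longleftrightarrow> z = x"
    "\<And>e y z. e \<in> E \<Longrightarrow> y \<in> e \<Longrightarrow> z \<in> e \<Longrightarrow> lev z \<le> Suc (lev y)"
    "\<And>z i. z \<in> V \<Longrightarrow> lev z = Suc i \<Longrightarrow> \<exists>e\<in>E. z \<in> e \<and> (\<exists>y\<in>e. lev y = i)"
    using level_function[OF x] by blast
  define n where "n i = card {y\<in>V. lev y = i}" for i
  define Q where "Q i = (if i = 0 then r * (u - 1) else (r - 1) * (u - 1))" for i :: nat
  define up where "up y = (\<Sum>z\<in>V. adj E y z * (if lev z = Suc (lev y) then 1 else 0))" for y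
  have up: "up y \<le> Q (lev y)" if y: "y \<in> V" for y
  proof -
    have eq: "up y = (\<Sum>e\<in>{e\<in>E. y \<in> e}. real (card {z\<in>e - {y}. lev z = Suc (lev y)}))"
      unfolding up_def sum_adj
      by (intro sum.cong refl) (auto simp: sum.If_cases finite_edge Int_def)
    have le: "real (card {z\<in>e - {y}. lev z = Suc (lev y)}) \<le> real (u - 1)" if "e \<in> {e\<in>E. y \<in> e}" for e
    proof -
      have "card {z\<in>e - {y}. lev z = Suc (lev y)} \<le> card (e - {y})"
        using that by (intro card_mono) (auto simp: finite_edge)
      then show ?thesis using that by (simp add: card_edge finite_edge)
    qed
    show ?thesis
    proof (cases "lev y")
      case 0
      have "up y \<le> (\<Sum>e\<in>{e\<in>E. y \<in> e}. real (u - 1))" unfolding eq by (rule sum_mono) (rule le)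
      then show ?thesis using y 0 by (simp add: Q_def degree)
    next
      case (Suc i)
      then obtain e p where e: "e \<in> E" "y \<in> e" "p \<in> e" "lev p = i" using lev(3)[OF y] by blast
      \<comment> \<open>An edge reaching back to level \<open>i\<close> contains no vertex beyond
        level \<open>Suc i\<close>. It contributes nothing outwards, so only \<open>r - 1\<close>
        edges remain.\<close>
      have "{z\<in>e - {y}. lev z = Suc (lev y)} = {}"
        using lev(2)[OF e(1) e(3)] e(4) Suc by fastforce
      then have "card {z\<in>e - {y}. lev z = Suc (lev y)} = 0" by (simp only: card.empty)
      then have "up y = (\<Sum>e\<in>{e\<in>E. y \<in> e} - {e}. real (card {z\<in>e - {y}. lev z = Suc (lev y)}))"
        unfolding eq using e finite_E by (subst sum.remove[of _ e]) (simp_all del: card_eq_0_iff)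
      also have "\<dots> \<le> (\<Sum>e\<in>{e\<in>E. y \<in> e} - {e}. real (u - 1))" by (rule sum_mono) (rule le, simp)
      also have "\<dots> = real ((r - 1) * (u - 1))"
        using e y degree finite_E by (simp add: card_Diff_singleton)
      finally show ?thesis using Suc by (simp add: Q_def)
    qed
  qed
  have n0: "n 0 = 1"
  proof -
    have "{y\<in>V. lev y = 0} = {x}" using x lev(1) by auto
    then show ?thesis by (simp add: n_def)
  qed
  have nS: "n (Suc i) \<le> Q i * n i" for i
  proof -
    \<comment> \<open>Every vertex of the next sphere has an adjacency to the current one; double
      counting these adjacencies bounds the next sphere by outward degrees.\<close>
    have ge: "1 \<le> (\<Sum>y\<in>{y\<in>V. lev y = i}. adj E y z)" if z: "z \<in> {z\<in>V. lev z = Suc i}" for z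
    proof -
      obtain e y where e: "e \<in> E" "z \<in> e" "y \<in> e" "lev y = i" using lev(3) z by blast
      then have "y \<noteq> z" using z by auto
      then have "1 \<le> adj E y z" by (rule adj_pos[OF e(1,3,2)])
      also have "\<dots> \<le> (\<Sum>y\<in>{y\<in>V. lev y = i}. adj E y z)"
        using e edge_subset finite_V by (intro member_le_sum) (auto simp: adj_nonneg)
      finally show ?thesis .
    qed
    have "real (n (Suc i)) = (\<Sum>z\<in>{z\<in>V. lev z = Suc i}. 1)" by (simp add: n_def)
    also have "\<dots> \<le> (\<Sum>z\<in>{z\<in>V. lev z = Suc i}. \<Sum>y\<in>{y\<in>V. lev y = i}. adj E y z)"
      by (rule sum_mono) (rule ge)
    also have "\<dots> = (\<Sum>y\<in>{y\<in>V. lev y = i}. up y)"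
    proof (subst sum.swap, rule sum.cong[OF refl])
      fix y assume "y \<in> {y\<in>V. lev y = i}"
      then have "lev y = i" by simp
      then show "(\<Sum>z\<in>{z\<in>V. lev z = Suc i}. adj E y z) = up y"
        unfolding up_def by (intro sum.mono_neutral_cong_left) (auto simp: finite_V)
    qed
    also have "\<dots> \<le> (\<Sum>y\<in>{y\<in>V. lev y = i}. real (Q i))"
      by (rule sum_mono) (use up in auto)
    also have "\<dots> = real (Q i * n i)" by (simp add: n_def)
    finally show ?thesis by (simp only: of_nat_le_iff)
  qed
  have by_level: "(\<Sum>y\<in>V. h (lev y)) = (\<Sum>i\<le>d. n i * h i)" if h: "\<And>i. i > d \<Longrightarrow> h i = 0"
    for h :: "nat \<Rightarrow> real" and d
  proof -
    have "(\<Sum>y\<in>V. h (lev y)) = (\<Sum>y\<in>{y\<in>V. lev y \<le> d}. h (lev y))"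
      by (rule sum.mono_neutral_right) (use finite_V h in \<open>auto simp: not_le\<close>)
    also have "\<dots> = (\<Sum>i\<le>d. \<Sum>y\<in>{y \<in> {y\<in>V. lev y \<le> d}. lev y = i}. h (lev y))"
      by (rule sum.group[symmetric]) (auto simp: finite_V)
    also have "\<dots> = (\<Sum>i\<le>d. n i * h i)"
    proof (rule sum.cong[OF refl])
      fix i assume "i \<in> {..d}"
      then have "{y \<in> {y\<in>V. lev y \<le> d}. lev y = i} = {y\<in>V. lev y = i}" by auto
      then show "(\<Sum>y\<in>{y \<in> {y\<in>V. lev y \<le> d}. lev y = i}. h (lev y)) = n i * h i"
        by (simp add: n_def)
    qed
    finally show ?thesis .
  qed
  have main: "card V * (\<Sum>i\<le>d. n i * ((r * (u - 1) - b) * (w i)\<^sup>2 - Q i * (w i - w (Suc i))\<^sup>2))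
      \<le> (r * (u - 1) - b) * (\<Sum>i\<le>d. n i * w i)\<^sup>2" if w: "\<And>i. i > d \<Longrightarrow> w i = 0"
    for w :: "nat \<Rightarrow> real" and d
  proof -
    have w': "(r * (u - 1) - b) * (w i)\<^sup>2 - Q i * (w i - w (Suc i))\<^sup>2 = 0" if "i > d" for i
      using w[of i] w[of "Suc i"] that by simp
    have arith: "S \<le> F - b * N"
      if "X = 2 * P" "P = U" "U \<le> W" "X = 2 * (k * N - F)" "S = (k - b) * N - W"
      for X P U W k N F S :: real
      using that by (simp add: left_diff_distrib)
    have by_w: "(\<Sum>y\<in>V. w (lev y)) = (\<Sum>i\<le>d. n i * w i)"
      by (rule by_level[OF w])
    have by_d: "(\<Sum>y\<in>V. (real (r * (u - 1)) - b) * (w (lev y))\<^sup>2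
          - real (Q (lev y)) * (w (lev y) - w (Suc (lev y)))\<^sup>2) =
        (\<Sum>i\<le>d. n i * ((r * (u - 1) - b) * (w i)\<^sup>2 - Q i * (w i - w (Suc i))\<^sup>2))"
      by (rule by_level[OF w'])
    define f where "f y = w (lev y)" for y
    define D where "D y = (w (lev y) - w (Suc (lev y)))\<^sup>2" for y
    define I where "I y z = (if lev z = Suc (lev y) then 1 else 0 :: real)" for y z
    \<comment> \<open>Levels of adjacent vertices differ by at most one and equal levels give zero,
      so each remaining ordered pair is charged to its endpoint nearer to the centre.\<close>
    have split: "adj E y z * (f y - f z)\<^sup>2 = adj E y z * I y z * D y + adj E z y * I z y * D z"
      for y z
    proof (cases "\<exists>e\<in>E. y \<in> e \<and> z \<in> e")
      case True
      then obtain e where e: "e \<in> E" "y \<in> e" "z \<in> e" by blast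
      then have "lev z \<le> Suc (lev y)" "lev y \<le> Suc (lev z)" using lev(2) by auto
      then consider "lev y = lev z" | "lev z = Suc (lev y)" | "lev y = Suc (lev z)" by linarith
      then show ?thesis
      proof cases
        case 3
        have "(f y - f z)\<^sup>2 = D z" unfolding f_def D_def 3 by (rule power2_commute)
        then show ?thesis using 3 by (simp add: I_def adj_sym[of E y z])
      qed (simp_all add: f_def D_def I_def)
    next
      case False
      then have "{e\<in>E. {y, z} \<subseteq> e} = {}" by auto
      then have "adj E y z = 0" unfolding adj_def by (simp only: card.empty of_nat_0 if_cancel)
      then show ?thesis by (simp add: adj_sym[of E z y])
    qed
    have "(\<Sum>y\<in>V. \<Sum>z\<in>V. adj E z y * I z y * D z) = (\<Sum>y\<in>V. \<Sum>z\<in>V. adj E y z * I y z * D y)"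
      by (rule sum.swap)
    then have "(\<Sum>y\<in>V. \<Sum>z\<in>V. adj E y z * (f y - f z)\<^sup>2) = 2 * (\<Sum>y\<in>V. \<Sum>z\<in>V. adj E y z * I y z * D y)"
      unfolding split sum.distrib by linarith
    moreover have "(\<Sum>y\<in>V. \<Sum>z\<in>V. adj E y z * I y z * D y) = (\<Sum>y\<in>V. up y * D y)"
      unfolding up_def I_def sum_distrib_right ..
    moreover have "(\<Sum>y\<in>V. up y * D y) \<le> (\<Sum>y\<in>V. real (Q (lev y)) * D y)"
      by (rule sum_mono, rule mult_right_mono[OF up]) (simp_all add: D_def)
    moreover have "(\<Sum>y\<in>V. \<Sum>z\<in>V. adj E y z * (f y - f z)\<^sup>2) =
        2 * (real (r * (u - 1)) * (\<Sum>y\<in>V. (f y)\<^sup>2) - (\<Sum>y\<in>V. \<Sum>z\<in>V. adj E y z * f y * f z))"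
      by (rule laplacian_form[OF adj_sym row_sum])
    moreover have "(\<Sum>y\<in>V. (r * (u - 1) - b) * (f y)\<^sup>2 - real (Q (lev y)) * D y) =
        (r * (u - 1) - b) * (\<Sum>y\<in>V. (f y)\<^sup>2) - (\<Sum>y\<in>V. real (Q (lev y)) * D y)"
      by (simp only: sum_subtractf sum_distrib_left)
    ultimately have "(\<Sum>y\<in>V. (r * (u - 1) - b) * (f y)\<^sup>2 - real (Q (lev y)) * D y)
        \<le> (\<Sum>y\<in>V. \<Sum>z\<in>V. adj E y z * f y * f z) - b * (\<Sum>y\<in>V. (f y)\<^sup>2)"
      by (rule arith)
   then have "card V * (\<Sum>y\<in>V. (r * (u - 1) - b) * (f y)\<^sup>2 - real (Q (lev y)) * D y)
        \<le> card V * ((\<Sum>y\<in>V. \<Sum>z\<in>V. adj E y z * f y * f z) - b * (\<Sum>y\<in>V. (f y)\<^sup>2))"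
      by (rule mult_left_mono) simp
    also have "\<dots> \<le> (r * (u - 1) - b) * (\<Sum>y\<in>V. f y)\<^sup>2"
      by (rule test_function_bound[OF b])
    finally show ?thesis
      unfolding f_def D_def by_w by_d .
  qed
  have "n 1 \<le> r * (u - 1)" "\<And>i. n (Suc (Suc i)) \<le> (r - 1) * (u - 1) * n (Suc i)"
    using nS[of 0] n0 nS[of "Suc _"] by (simp_all add: Q_def)
  with n0 main show ?thesis unfolding sphere_tests_def Q_def by blast
qed

end

section \<open>The order bound\<close>

lemma sphere_testsE:
  assumes "sphere_tests v k q \<kappa>"
  obtains n :: "nat \<Rightarrow> nat" where "n 0 = 1" "n (Suc 0) \<le> k"
    "\<forall>i. n (Suc (Suc i)) \<le> q * n (Suc i)"
    "\<forall>(w :: nat \<Rightarrow> real) d. (\<forall>i>d. w i = 0) \<longrightarrow>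
      v * (\<Sum>i\<le>d. n i * (\<kappa> * (w i)\<^sup>2 - real (if i = 0 then k else q) * (w i - w (Suc i))\<^sup>2))
         \<le> \<kappa> * (\<Sum>i\<le>d. n i * w i)\<^sup>2"
  using assms unfolding sphere_tests_def by (elim exE conjE) (rule that, assumption, simp, assumption+)

text \<open>Here \<open>\<kappa> = q\<close>, its value for \<open>l = 1\<close>. Weight 1 on the
  first sphere then contributes nothing on the left, since its drop to 0 costs exactly
  \<open>q\<close>, and only the weight at the centre remains free.\<close>

lemma sphere_tests_radius_1:
  fixes p :: nat
  assumes "sphere_tests v k q q" and k: "k = q + p" and "q > 0"
  shows "v \<le> 1 + real k + real k * (real p + 1)"
proof -
  obtain n :: "nat \<Rightarrow> nat" where n: "n 0 = 1" "n (Suc 0) \<le> k"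
      "\<forall>i. n (Suc (Suc i)) \<le> q * n (Suc i)"
    and test: "\<forall>(w :: nat \<Rightarrow> real) d. (\<forall>i>d. w i = 0) \<longrightarrow>
      v * (\<Sum>i\<le>d. n i * (q * (w i)\<^sup>2 - real (if i = 0 then k else q) * (w i - w (Suc i))\<^sup>2))
         \<le> q * (\<Sum>i\<le>d. n i * w i)\<^sup>2"
    by (rule sphere_testsE[OF assms(1)])
  \<comment> \<open>the weight at the centre minimises the resulting bound on \<open>v\<close>\<close>
  define c where "c = (real k + 1) / (real p + 1)"
  define w :: "nat \<Rightarrow> real" where "w i = (if i = 0 then c else if i = 1 then 1 else 0)" for i
  have c: "c * (real p + 1) = real k + 1" by (simp add: c_def)
  have c0: "c > 0" by (simp add: c_def)
  have "v * (q * c\<^sup>2 - k * (c - 1)\<^sup>2) \<le> q * (c + n (Suc 0))\<^sup>2"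
    using test[rule_format, of 1 w] n(1) by (simp add: w_def)
  also have "\<dots> \<le> q * (c + k)\<^sup>2"
    using n(2) c0 by (intro mult_left_mono power_mono) auto
  finally have "v * (q * c\<^sup>2 - k * (c - 1)\<^sup>2) \<le> q * (c + k)\<^sup>2" .
  \<comment> \<open>For this \<open>c\<close> the form has the factor \<open>c + k\<close>, which
    occurs squared on the right, so one factor cancels.\<close>
  moreover have "(real p + 1) * (q * c\<^sup>2 - k * (c - 1)\<^sup>2) = q * (c + k)"
  proof -
    have q: "real q = real k - real p" using k by simp
    have "(real p + 1) * (q * c\<^sup>2 - k * (c - 1)\<^sup>2) = 2 * real k * (c * (real p + 1)) - real k * (real p + 1) - real p * c * (c * (real p + 1))"
      unfolding q by (simp add: power2_eq_square algebra_simps)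
    also have "\<dots> = 2 * real k * (real k + 1) - real k * (real p + 1) - real p * c * (real k + 1)" unfolding c ..
    also have "\<dots> = q * (c + k) + real k * (real k + 1 - c * (real p + 1))"
      unfolding q by (simp add: algebra_simps)
    finally show ?thesis unfolding c by simp
  qed
  ultimately have "v * (q * (c + k)) \<le> (real p + 1) * (q * (c + k)\<^sup>2)"
  proof -
    assume a: "v * (q * c\<^sup>2 - k * (c - 1)\<^sup>2) \<le> q * (c + k)\<^sup>2"
      and e: "(real p + 1) * (q * c\<^sup>2 - k * (c - 1)\<^sup>2) = q * (c + k)"
    have "(real p + 1) * (v * (q * c\<^sup>2 - k * (c - 1)\<^sup>2)) \<le> (real p + 1) * (q * (c + k)\<^sup>2)"
      using a by (intro mult_left_mono) auto
    then show ?thesis unfolding e[symmetric] by (simp only: mult.left_commute)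
  qed
  then have "(q * (c + k)) * v \<le> (q * (c + k)) * ((real p + 1) * (c + k))"
    by (simp add: power2_eq_square mult_ac)
  moreover have "q * (c + k) > 0" using c0 \<open>q > 0\<close> by (intro mult_pos_pos) auto
  ultimately have "v \<le> (real p + 1) * (c + k)" by (rule mult_left_le_imp_le)
  also have "\<dots> = c * (real p + 1) + real k * (real p + 1)" by (simp add: algebra_simps)
  also have "\<dots> = 1 + real k + real k * (real p + 1)" unfolding c by simp
  finally show ?thesis by simp
qed

text \<open>Consecutive weights have ratio \<open>s\<close>, so on each inner sphere the gradient
  term uses up \<open>(s - 1)\<^sup>2\<close> and leaves a gain of \<open>\<epsilon>\<close>, while
  the drop to zero at the boundary costs \<open>m * \<epsilon>\<close>. The rescaled sphere sizes
  \<open>x i\<close> do not increase, hence the \<open>m\<close> gains cover this loss.\<close>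

lemma sphere_tests_geometric:
  fixes s :: real
  assumes tests: "sphere_tests v k q ((s - 1)\<^sup>2 + (2 * s - 1) / l)"
    and s: "s > 1" "s\<^sup>2 = q" and l: "l \<ge> 1"
  shows "v \<le> (1 + k * (\<Sum>i<l. s ^ i))\<^sup>2"
proof -
  obtain m where m: "l = Suc m" using l by (cases l) auto
  define \<epsilon> where "\<epsilon> = (2 * s - 1) / l"
  define \<kappa> where "\<kappa> = (s - 1)\<^sup>2 + \<epsilon>"
  have \<epsilon>: "\<epsilon> > 0" using s l by (simp add: \<epsilon>_def)
  have \<kappa>: "\<kappa> > 0" using \<epsilon> by (simp add: \<kappa>_def add_nonneg_pos)
  obtain n :: "nat \<Rightarrow> nat" where n: "n 0 = 1" "n (Suc 0) \<le> k"
      "\<forall>i. n (Suc (Suc i)) \<le> q * n (Suc i)"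
    and test: "\<forall>(w :: nat \<Rightarrow> real) d. (\<forall>i>d. w i = 0) \<longrightarrow>
      v * (\<Sum>i\<le>d. n i * (\<kappa> * (w i)\<^sup>2 - real (if i = 0 then k else q) * (w i - w (Suc i))\<^sup>2))
         \<le> \<kappa> * (\<Sum>i\<le>d. n i * w i)\<^sup>2"
    by (rule sphere_testsE[OF tests[folded \<epsilon>_def, folded \<kappa>_def]])
  have "s\<^sup>2 > 0" using s(1) by simp
  then have q: "real q > 0" using s(2) by simp
  \<comment> \<open>The centre has the same weight as the first sphere, so no gradient term arises
    there and it contributes the full \<open>\<kappa>\<close>.\<close>
  define w :: "nat \<Rightarrow> real" where "w i = (if i = 0 then 1 else if i \<le> l then 1 / s ^ (i - 1) else 0)" for i
  define x where "x i = n (Suc i) / real q ^ i" for i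
  have wS: "w (Suc i) = 1 / s ^ i" if "i \<le> m" for i using that by (simp add: w_def m)
  have w2: "(w (Suc i))\<^sup>2 = 1 / real q ^ i" if "i \<le> m" for i
  proof -
    have "(s ^ i)\<^sup>2 = real q ^ i" unfolding s(2)[symmetric] by (simp flip: power_mult add: mult.commute)
    then show ?thesis using that by (simp add: wS power_divide)
  qed
  have x_Suc: "x (Suc i) \<le> x i" for i
  proof -
    have "real (n (Suc (Suc i))) \<le> q * n (Suc i)" using n(3)[rule_format, of i] by (metis of_nat_le_iff of_nat_mult)
    then show ?thesis using q by (simp add: x_def field_simps)
  qed
  then have x_anti: "x j \<le> x i" if "i \<le> j" for i j
    using that by (rule lift_Suc_antimono_le)
  have x_le: "x i \<le> k" for i using x_anti[of 0 i] n(2) by (simp add: x_def)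
  have x0: "x i \<ge> 0" for i by (simp add: x_def)
  let ?g = "\<lambda>i. n i * (\<kappa> * (w i)\<^sup>2 - real (if i = 0 then k else q) * (w i - w (Suc i))\<^sup>2)"
  have g0: "?g 0 = \<kappa>" using n(1) by (simp add: w_def m)
  have gi: "?g (Suc i) = \<epsilon> * x i" if "i < m" for i
  proof -
    have "real q * (w (Suc i) - w (Suc (Suc i)))\<^sup>2 = (s - 1)\<^sup>2 * (w (Suc i))\<^sup>2"
    proof -
      have "w (Suc i) = s * w (Suc (Suc i))" using that s(1) by (simp add: wS)
      then show ?thesis unfolding s(2)[symmetric] by (simp add: power2_eq_square algebra_simps)
    qed
    then have "?g (Suc i) = n (Suc i) * (\<epsilon> * (w (Suc i))\<^sup>2)"
      by (simp add: \<kappa>_def algebra_simps)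
    then show ?thesis using that by (simp add: w2 x_def)
  qed
  \<comment> \<open>Here the value of \<open>\<epsilon>\<close> matters: \<open>\<kappa> - q =
    \<epsilon> - (2 * s - 1) = \<epsilon> - l * \<epsilon>\<close>, with
    \<open>l = Suc m\<close>.\<close>
  have gm: "?g (Suc m) = - m * \<epsilon> * x m"
  proof -
    have "w (Suc (Suc m)) = 0" by (simp add: w_def m)
    then have "?g (Suc m) = n (Suc m) * ((\<kappa> - q) * (w (Suc m))\<^sup>2)" by (simp add: algebra_simps)
    also have "\<dots> = (\<kappa> - q) * x m" by (simp add: w2 x_def)
    also have "\<kappa> - q = - m * \<epsilon>"
    proof -
      have "\<epsilon> * l = 2 * s - 1" using l by (simp add: \<epsilon>_def)
      then have "\<epsilon> + m * \<epsilon> = 2 * s - 1" by (simp add: m algebra_simps)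
      then show ?thesis unfolding \<kappa>_def s(2)[symmetric] by (simp add: power2_eq_square algebra_simps)
    qed
    finally show ?thesis .
  qed
  have peel: "(\<Sum>i\<le>Suc m. h i) = h 0 + ((\<Sum>i<m. h (Suc i)) + h (Suc m))" for h :: "nat \<Rightarrow> real"
    by (subst sum.atMost_Suc_shift, subst lessThan_Suc_atMost[symmetric]) simp
  have "(\<Sum>i\<le>l. ?g i) = ?g 0 + ((\<Sum>i<m. ?g (Suc i)) + ?g (Suc m))"
    unfolding m by (rule peel)
  also have "\<dots> = \<kappa> + \<epsilon> * ((\<Sum>i<m. x i) - (\<Sum>i<m. x m))"
  proof -
    have "(\<Sum>i<m. ?g (Suc i)) = (\<Sum>i<m. \<epsilon> * x i)" by (rule sum.cong[OF refl], rule gi) simp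
    then show ?thesis unfolding g0 gm by (simp add: algebra_simps flip: sum_distrib_left)
  qed
  also have "\<dots> \<ge> \<kappa>"
    using \<epsilon> sum_mono[of "{..<m}" "\<lambda>_. x m" x] x_anti by simp
  finally have D: "(\<Sum>i\<le>l. ?g i) \<ge> \<kappa>" .
  have "(\<Sum>i\<le>l. n i * w i) = 1 + (\<Sum>i\<le>m. n (Suc i) * w (Suc i))"
    unfolding m sum.atMost_Suc_shift by (simp add: n(1) w_def)
  also have "(\<Sum>i\<le>m. n (Suc i) * w (Suc i)) \<le> (\<Sum>i\<le>m. k * s ^ i)"
  proof (rule sum_mono)
    fix i assume "i \<in> {..m}"
    then have "n (Suc i) * w (Suc i) = x i * s ^ i"
      using s(1) by (simp add: wS x_def power2_eq_square power_mult_distrib flip: s(2))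
    also have "\<dots> \<le> k * s ^ i" using s(1) x_le by (intro mult_right_mono) auto
    finally show "n (Suc i) * w (Suc i) \<le> k * s ^ i" .
  qed
  finally have W: "(\<Sum>i\<le>l. n i * w i) \<le> 1 + k * (\<Sum>i<l. s ^ i)"
    by (simp add: sum_distrib_left m lessThan_Suc_atMost)
  have W0: "0 \<le> (\<Sum>i\<le>l. n i * w i)" using s(1) by (intro sum_nonneg) (simp add: w_def)
  show ?thesis
  proof (cases "v \<ge> 0")
    case True
    have "v * \<kappa> \<le> v * (\<Sum>i\<le>l. ?g i)" using D True by (rule mult_left_mono)
    also have "\<dots> \<le> \<kappa> * (\<Sum>i\<le>l. n i * w i)\<^sup>2" by (rule test[rule_format]) (simp add: w_def)
    also have "\<dots> \<le> \<kappa> * (1 + k * (\<Sum>i<l. s ^ i))\<^sup>2"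
      using W W0 \<kappa> by (intro mult_left_mono power_mono) auto
    finally show ?thesis using \<kappa> by (simp add: mult.commute)
  next
    case False
    then show ?thesis by (meson order_trans zero_le_power2 linear)
  qed
qed

text \<open>Expanding the square reduces the claim to \<open>2 * S + k * S\<^sup>2 < P\<close>. With
  the closed forms of both geometric sums, \<open>le\<close> is a sufficient condition for this in
  terms of \<open>s\<close>, \<open>t\<close> and \<open>k\<close>.\<close>

lemma square_geometric_sum_less:
  fixes s t k :: real
  assumes s: "s > 1" and t: "t = s ^ l" and l: "l \<ge> 2" and k: "k > 0"
    and le: "2 + k * (s + 1) \<le> (s - 1) * (t\<^sup>2 + 2 * t + 3)"
  shows "(1 + k * (\<Sum>i<l. s ^ i))\<^sup>2 < 1 + k * (\<Sum>j<2 * l. (s\<^sup>2) ^ j)"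
proof -
  have ts: "t \<ge> s\<^sup>2" unfolding t using s l by (intro power_increasing) auto
  have s2: "s\<^sup>2 > 1" using s by (simp add: one_less_power)
  have t1: "t > 1" using ts s2 by simp
  define S P where "S = (\<Sum>i<l. s ^ i)" and "P = (\<Sum>j<2 * l. (s\<^sup>2) ^ j)"
  have S: "S * (s - 1) = t - 1"
    unfolding S_def t using power_diff_1_eq[of s l] by (simp add: mult.commute)
  have P: "P * (s\<^sup>2 - 1) = t ^ 4 - 1"
  proof -
    have "(s\<^sup>2) ^ (2 * l) = t ^ 4" unfolding t by (simp add: mult.commute flip: power_mult)
    then show ?thesis
      unfolding P_def using power_diff_1_eq[of "s\<^sup>2" "2 * l"] by (simp add: mult.commute)
  qed
  have "(t - 1) * (k * (s + 1)) \<le> (t - 1) * ((s - 1) * (t\<^sup>2 + 2 * t + 3) - 2)"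
    using le t1 by (intro mult_left_mono) auto
  \<comment> \<open>Uses \<open>(t - 1) * (t\<^sup>2 + 2 * t + 3) = (t + 1) * (t\<^sup>2 + 1) -
    4\<close>. Next, \<open>2 * (t - 1)\<close> absorbs \<open>2 * (s\<^sup>2 - 1)\<close> because
    \<open>t \<ge> s\<^sup>2\<close>, and the surplus \<open>4 * (s - 1)\<close> gives
    strictness.\<close>
  also have "\<dots> = (s - 1) * ((t + 1) * (t\<^sup>2 + 1) - 4) - 2 * (t - 1)"
    by (simp add: power2_eq_square algebra_simps)
  finally have "2 * (s\<^sup>2 - 1) + k * (s + 1) * (t - 1) < (s - 1) * ((t + 1) * (t\<^sup>2 + 1))"
    using ts s by (simp add: algebra_simps)
  then have "(t - 1) * (2 * (s\<^sup>2 - 1) + k * (s + 1) * (t - 1)) < (t - 1) * ((s - 1) * ((t + 1) * (t\<^sup>2 + 1)))"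
    using t1 by (intro mult_strict_left_mono) auto
  also have "\<dots> = (s - 1) * (t ^ 4 - 1)" by (simp add: power2_eq_square power4_eq_xxxx algebra_simps)
  also have "\<dots> = (s - 1) * (s\<^sup>2 - 1) * P" unfolding P[symmetric] by simp
  also have "(t - 1) * (2 * (s\<^sup>2 - 1) + k * (s + 1) * (t - 1)) =
      (s - 1) * (s\<^sup>2 - 1) * (2 * S + k * S\<^sup>2)"
    unfolding S[symmetric] by (simp add: power2_eq_square algebra_simps)
  finally have "2 * S + k * S\<^sup>2 < P" using s s2 by (simp add: mult_less_cancel_left)
  then have "k * (2 * S + k * S\<^sup>2) < k * P" using k by (rule mult_strict_left_mono)
  then show ?thesis unfolding S_def[symmetric] P_def[symmetric]
    by (simp add: power2_eq_square algebra_simps)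
qed

lemma sqrt_2_bounds: "141 / 100 < sqrt (2::real)" "sqrt (2::real) < 3 / 2"
  by (rule real_less_rsqrt, simp add: power2_eq_square)
     (rule real_less_lsqrt, simp_all add: power2_eq_square)

text \<open>The geometric weights are too weak for cubic graphs with \<open>l = 2\<close> or \<open>l = 3\<close>; the weights
  used there come from a numerical optimisation.\<close>

lemma sphere_tests_cubic_2:
  assumes "sphere_tests v 3 2 \<kappa>" and \<kappa>: "\<kappa> = (sqrt 2 - 1)\<^sup>2 + (2 * sqrt 2 - 1) / 2"
  shows "v < 46"
proof -
  have k: "\<kappa> = 5 / 2 - sqrt 2" unfolding \<kappa> by (simp add: power2_eq_square field_simps)
  \<comment> \<open>Replacing \<open>b\<close> by \<open>2 * a\<close> gives \<open>a\<close> the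
    coefficient \<open>11 * \<kappa> - 12\<close>. Below \<open>12 / 11\<close> it is negative, so
    the largest spheres, of sizes 3 and 6, are the worst case.\<close>
  have kb: "\<kappa> > 1" "\<kappa> < 12 / 11" using sqrt_2_bounds unfolding k by auto
  obtain n :: "nat \<Rightarrow> nat" where n: "n 0 = 1" "n (Suc 0) \<le> 3" "\<forall>i. n (Suc (Suc i)) \<le> 2 * n (Suc i)"
    and test: "\<forall>(w :: nat \<Rightarrow> real) d. (\<forall>i>d. w i = 0) \<longrightarrow>
      v * (\<Sum>i\<le>d. n i * (\<kappa> * (w i)\<^sup>2 - real (if i = 0 then 3 else 2) * (w i - w (Suc i))\<^sup>2))
         \<le> \<kappa> * (\<Sum>i\<le>d. n i * w i)\<^sup>2"
    by (rule sphere_testsE[OF assms(1)])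
  define a b where "a = real (n (Suc 0))" and "b = real (n (Suc (Suc 0)))"
  have ab: "0 \<le> a" "0 \<le> b" "a \<le> 3" "b \<le> 2 * a"
    using n(2) n(3)[rule_format, of 0] unfolding a_def b_def by linarith+
  define w :: "nat \<Rightarrow> real" where "w i = (if i = 0 then 4 else if i = 1 then 3 else if i = 2 then 1 else 0)" for i
  have "v * (\<Sum>i\<le>2. n i * (\<kappa> * (w i)\<^sup>2 - real (if i = 0 then 3 else 2) * (w i - w (Suc i))\<^sup>2))
      \<le> \<kappa> * (\<Sum>i\<le>2. n i * w i)\<^sup>2"
    by (rule test[rule_format]) (simp add: w_def)
  then have *: "v * ((16 * \<kappa> - 3) + a * (9 * \<kappa> - 8) + b * (\<kappa> - 2)) \<le> \<kappa> * (4 + 3 * a + b)\<^sup>2"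
    using n(1) by (simp add: w_def numeral_2_eq_2 a_def b_def algebra_simps)
  have "49 * \<kappa> - 39 \<le> (16 * \<kappa> - 3) + a * (9 * \<kappa> - 8) + b * (\<kappa> - 2)"
  proof -
    have "2 * a * (\<kappa> - 2) \<le> b * (\<kappa> - 2)" using ab kb by (intro mult_right_mono_neg) auto
    moreover have "3 * (11 * \<kappa> - 12) \<le> a * (11 * \<kappa> - 12)"
      using ab kb by (intro mult_right_mono_neg) auto
    ultimately show ?thesis using kb by (simp add: algebra_simps)
  qed
  \<comment> \<open>Sphere sizes 3 and 6 give 4 + 9 + 6 = 19. The target 46 is 1 + 3 (1 + 2 + 4 +
    8).\<close>
  moreover have "\<kappa> * (4 + 3 * a + b)\<^sup>2 \<le> \<kappa> * 19\<^sup>2"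
    using ab kb by (intro mult_left_mono power_mono) auto
  ultimately have "v * (49 * \<kappa> - 39) \<le> 361 * \<kappa>" if "v \<ge> 0"
    using * that mult_left_mono[of "49 * \<kappa> - 39" _ v] by fastforce
  show ?thesis
  proof (rule ccontr)
    assume "\<not> v < 46"
    then have "46 * (49 * \<kappa> - 39) \<le> v * (49 * \<kappa> - 39)" using kb by (intro mult_right_mono) auto
    then show False using \<open>v \<ge> 0 \<Longrightarrow> _\<close> \<open>\<not> v < 46\<close> kb by simp
  qed
qed

lemma sphere_tests_cubic_3:
  assumes "sphere_tests v 3 2 \<kappa>" and \<kappa>: "\<kappa> = (sqrt 2 - 1)\<^sup>2 + (2 * sqrt 2 - 1) / 3"
  shows "v < 190"
proof -
  have k: "\<kappa> = 8 / 3 - 4 / 3 * sqrt 2" unfolding \<kappa> by (simp add: power2_eq_square field_simps)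
  \<comment> \<open>These bounds fix the signs met when \<open>c\<close>, \<open>b\<close> and
    \<open>a\<close> are eliminated in turn: \<open>24 * \<kappa> - 24\<close> is negative, and
    \<open>84 * \<kappa> - 56\<close> vanishes at \<open>2 / 3\<close>.\<close>
  have kb: "\<kappa> \<ge> 2 / 3" "\<kappa> < 1" using sqrt_2_bounds unfolding k by auto
  obtain n :: "nat \<Rightarrow> nat" where n: "n 0 = 1" "n (Suc 0) \<le> 3" "\<forall>i. n (Suc (Suc i)) \<le> 2 * n (Suc i)"
    and test: "\<forall>(w :: nat \<Rightarrow> real) d. (\<forall>i>d. w i = 0) \<longrightarrow>
      v * (\<Sum>i\<le>d. n i * (\<kappa> * (w i)\<^sup>2 - real (if i = 0 then 3 else 2) * (w i - w (Suc i))\<^sup>2))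
         \<le> \<kappa> * (\<Sum>i\<le>d. n i * w i)\<^sup>2"
    by (rule sphere_testsE[OF assms(1)])
  define a b c where "a = real (n (Suc 0))" and "b = real (n (Suc (Suc 0)))"
    and "c = real (n (Suc (Suc (Suc 0))))"
  have ab: "0 \<le> a" "0 \<le> b" "0 \<le> c" "a \<le> 3" "b \<le> 2 * a" "c \<le> 2 * b"
    using n(2) n(3)[rule_format, of 0] n(3)[rule_format, of 1] unfolding a_def b_def c_def One_nat_def by linarith+
  define w :: "nat \<Rightarrow> real" where
    "w i = (if i = 0 then 7 else if i = 1 then 6 else if i = 2 then 4 else if i = 3 then 2 else 0)" for i
  have "v * (\<Sum>i\<le>3. n i * (\<kappa> * (w i)\<^sup>2 - real (if i = 0 then 3 else 2) * (w i - w (Suc i))\<^sup>2))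
      \<le> \<kappa> * (\<Sum>i\<le>3. n i * w i)\<^sup>2"
    by (rule test[rule_format]) (simp add: w_def)
  then have *: "v * ((49 * \<kappa> - 3) + a * (36 * \<kappa> - 8) + b * (16 * \<kappa> - 8) + c * (4 * \<kappa> - 8))
      \<le> \<kappa> * (7 + 6 * a + 4 * b + 2 * c)\<^sup>2"
    using n(1) by (simp add: w_def numeral_3_eq_3 numeral_2_eq_2 a_def b_def c_def algebra_simps)
  have "49 * \<kappa> - 3 \<le> (49 * \<kappa> - 3) + a * (36 * \<kappa> - 8) + b * (16 * \<kappa> - 8) + c * (4 * \<kappa> - 8)"
  proof -
    have "2 * b * (4 * \<kappa> - 8) \<le> c * (4 * \<kappa> - 8)" using ab kb by (intro mult_right_mono_neg) auto
    moreover have "2 * a * (24 * \<kappa> - 24) \<le> b * (24 * \<kappa> - 24)"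
      using ab kb by (intro mult_right_mono_neg) auto
    moreover have "0 \<le> a * (84 * \<kappa> - 56)" using ab kb by (intro mult_nonneg_nonneg) auto
    ultimately show ?thesis by (simp add: algebra_simps)
  qed
  \<comment> \<open>Sphere sizes 3, 6 and 12 give 7 + 18 + 24 + 24 = 73. The target 190 is 1 + 3 (1
    + 2 + 4 + 8 + 16 + 32).\<close>
  moreover have "\<kappa> * (7 + 6 * a + 4 * b + 2 * c)\<^sup>2 \<le> \<kappa> * 73\<^sup>2"
    using ab kb by (intro mult_left_mono power_mono) auto
  ultimately have "v * (49 * \<kappa> - 3) \<le> 5329 * \<kappa>" if "v \<ge> 0"
    using * that mult_left_mono[of "49 * \<kappa> - 3" _ v] by fastforce
  show ?thesis
  proof (rule ccontr)
    assume "\<not> v < 190"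
    then have "190 * (49 * \<kappa> - 3) \<le> v * (49 * \<kappa> - 3)" using kb by (intro mult_right_mono) auto
    then show False using \<open>v \<ge> 0 \<Longrightarrow> _\<close> \<open>\<not> v < 190\<close> kb by simp
  qed
qed

lemma sphere_tests_order_bound:
  fixes p m l k q :: nat and s :: real
  assumes p: "p \<ge> 1" and m: "m \<ge> 2" and l: "l \<ge> 2"
    and k: "k = (m + 1) * p" and q: "q = m * p" and s: "s = sqrt q"
    and tests: "sphere_tests v k q ((s - 1)\<^sup>2 + (2 * s - 1) / l)"
  shows "v < 1 + k * (\<Sum>j<2 * l. real q ^ j)"
proof -
  \<comment> \<open>As \<open>m \<ge> 2\<close> divides the prime \<open>q\<close>, this forces
    \<open>p = 1\<close>. Since \<open>p\<close> stands for \<open>u - 1\<close>, these are the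
    cases of graphs.\<close>
  have small: "m = d \<and> p = 1" if "q = d" "d = 2 \<or> d = 3" for d
  proof -
    have "m * p = d" using that q by simp
    moreover have "m \<le> m * p" using p by simp
    ultimately have "m = 2 \<or> m = 3" using m that by linarith
    then show ?thesis using \<open>m * p = d\<close> that p by (elim disjE) (auto, presburger?)
  qed
  show ?thesis
  proof (cases "q = 2 \<and> l \<le> 3")
    case True
    have "m = 2 \<and> p = 1" using small[of 2] True by auto
    then have k3: "k = 3" using True q k by simp
    consider "l = 2" | "l = 3" using True l by linarith
    then show ?thesis
    proof cases
      case 1
      then have "v < 46" using sphere_tests_cubic_2[of v] tests True k3 s by simp
      then show ?thesis using True k3 1 by (simp add: eval_nat_numeral)
    next
      case 2
      then have "v < 190" using sphere_tests_cubic_3[of v] tests True k3 s by simp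
      then show ?thesis using True k3 2 by (simp add: eval_nat_numeral)
    qed
  next
    case False
    have q2: "q \<ge> 2" using p m mult_le_mono[of 2 m 1 p] unfolding q by simp
    have s2: "s\<^sup>2 = q" by (simp add: s)
    have s1: "s > 1" using q2 unfolding s by simp
    have "v \<le> (1 + k * (\<Sum>i<l. s ^ i))\<^sup>2"
      by (rule sphere_tests_geometric[OF tests s1 s2]) (use l in simp)
    also have "\<dots> < 1 + k * (\<Sum>j<2 * l. (s\<^sup>2) ^ j)"
    proof (rule square_geometric_sum_less[OF s1 refl l])
      have "k > 0" using p k by simp
      then show "real k > 0" by simp
      define t where "t = s ^ l"
      have mono: "(s - 1) * (t0\<^sup>2 + 2 * t0 + 3) \<le> (s - 1) * (t\<^sup>2 + 2 * t + 3)" if "0 \<le> t0" "t0 \<le> t" for t0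
        using that s1 by (intro mult_left_mono add_mono power_mono) auto
      have tq: "q \<le> t" unfolding t_def s2[symmetric] using s1 l by (intro power_increasing) auto
      consider "q = 2" "l \<ge> 4" | "q = 3" | "q \<ge> 4" using q2 False by linarith
      then have "2 + k * (s + 1) \<le> (s - 1) * (t\<^sup>2 + 2 * t + 3)"
      proof cases
        case 1
        then have "m = 2 \<and> p = 1" using small by simp
        then have k3: "k = 3" using k by simp
        have "4 = s ^ 4" using 1 s2 by (simp add: power4_eq_xxxx power2_eq_square)
        also have "\<dots> \<le> t" unfolding t_def using s1 1 by (intro power_increasing) auto
        finally have "(s - 1) * 27 \<le> (s - 1) * (t\<^sup>2 + 2 * t + 3)" using mono[of 4] by simp
        moreover have "s > 7 / 5" using sqrt_2_bounds 1 s by simp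
        ultimately show ?thesis using k3 by simp
      next
        case 2
        then have "m = 3 \<and> p = 1" using small by simp
        then have k4: "k = 4" using k by simp
        have "(s - 1) * 18 \<le> (s - 1) * (t\<^sup>2 + 2 * t + 3)" using mono[of 3] tq 2 by simp
        \<comment> \<open>The exact threshold of
          \<open>2 + 4 * (s + 1) \<le> 18 * (s - 1)\<close>.\<close>
        moreover have "s > 12 / 7" unfolding s 2 by (rule real_less_rsqrt) (simp add: power2_eq_square)
        ultimately show ?thesis using k4 by simp
      next
        case 3
        have ss: "s \<ge> 2" unfolding s using 3 real_le_rsqrt[of 2 "real q"] by simp
        have "2 * k \<le> 3 * q" using m unfolding k q by (simp add: algebra_simps)
        then have "k \<le> 3 / 2 * real q" by linarith
        \<comment> \<open>From \<open>s \<ge> 2\<close> follow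
          \<open>s + 1 \<le> 3 * (s - 1)\<close> and \<open>2 \<le> 2 * (s - 1)\<close>, so that
          \<open>s - 1\<close> becomes a common factor.\<close>
        then have "k * (s + 1) \<le> (3 / 2 * q) * (3 * (s - 1))"
          using ss by (intro mult_mono) auto
        then have "2 + k * (s + 1) \<le> 2 * (s - 1) + (3 / 2 * q) * (3 * (s - 1))"
          using ss by (intro add_mono) auto
        also have "\<dots> = (s - 1) * (2 + 9 / 2 * q)" by (simp add: field_simps)
        also have "\<dots> \<le> (s - 1) * ((real q)\<^sup>2 + 2 * q + 3)"
        proof (rule mult_left_mono)
          have "4 * real q \<le> (real q)\<^sup>2" unfolding power2_eq_square using 3 by (intro mult_right_mono) auto
          then show "2 + 9 / 2 * q \<le> (real q)\<^sup>2 + 2 * q + 3" by linarith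
        qed (use s1 in simp)
        also have "\<dots> \<le> (s - 1) * (t\<^sup>2 + 2 * t + 3)" using mono[of q] tq by simp
        finally show ?thesis .
      qed
      then show "2 + k * (s + 1) \<le> (s - 1) * ((s ^ l)\<^sup>2 + 2 * s ^ l + 3)" unfolding t_def .
    qed
    finally show ?thesis unfolding s2 .
  qed
qed

context regular_uniform_hg
begin

text \<open>The disjunction yields both the bound and the clause on equality. Strictness for
  \<open>l \<ge> 2\<close> comes from \<open>sphere_tests_order_bound\<close>; for
  \<open>l = 1\<close> it depends on comparing \<open>u\<close> with \<open>q\<close>.\<close>

lemma order_bound:
  assumes r: "r \<ge> 3" and u: "u \<ge> 2" and l: "l \<ge> 1"
    and k: "k = r * (u - 1)" and q: "q = (r - 1) * (u - 1)"
    and b: "second_eigenvalue V E \<le> real u - 2 + 2 * sqrt (real q) - (2 * sqrt (real q) - 1) / real l"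
  shows "card V < 1 + (\<Sum>j=0..2*l-1. k * q ^ j) \<or>
    (r, u, l) = (3, 2, 1) \<and> card V = 1 + (\<Sum>j=0..2*l-1. k * q ^ j)"
proof (cases "V = {}")
  case False
  then obtain x where x: "x \<in> V" by blast
  define p m where "p = u - 1" and "m = r - 1"
  have p: "p \<ge> 1" "u = p + 1" and m: "m \<ge> 2" "r = m + 1" using u r by (auto simp: p_def m_def)
  have k': "k = (m + 1) * p" "k = q + p" and q': "q = m * p"
    using k q p(2) m(2) by (simp_all add: algebra_simps)
  define s where "s = sqrt q"
  have q2: "q \<ge> 2" using p m mult_le_mono[of 2 m 1 p] unfolding q' by simp
  have s2: "s\<^sup>2 = q" by (simp add: s_def)
  have s1: "s > 1" using q2 unfolding s_def by simp
  define \<beta> where "\<beta> = real u - 2 + 2 * s - (2 * s - 1) / l"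
  have kb: "k - \<beta> = (s - 1)\<^sup>2 + (2 * s - 1) / l"
    unfolding \<beta>_def k'(2) of_nat_add s2[symmetric] p(2) by (simp add: power2_eq_square algebra_simps)
  have "(s - 1)\<^sup>2 + (2 * s - 1) / l > 0" using s1 l by (intro add_pos_pos) auto
  then have "\<beta> < real (r * (u - 1))" using kb unfolding k by simp
  moreover have "second_eigenvalue V E \<le> \<beta>" using b by (simp add: \<beta>_def s_def)
  ultimately have "sphere_tests (card V) k q (k - \<beta>)"
    using sphere_tests_card x unfolding k q by blast
  then have tests: "sphere_tests (card V) k q ((s - 1)\<^sup>2 + (2 * s - 1) / l)" unfolding kb .
  have M: "(\<Sum>j=0..2*l-1. k * q ^ j) = k * (\<Sum>j<2*l. q ^ j)"
  proof -
    have "{0..2*l-1} = {..<2*l}" using l by auto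
    then show ?thesis by (simp add: sum_distrib_left)
  qed
  show ?thesis
  proof (cases "l = 1")
    case True
    have "(s - 1)\<^sup>2 + (2 * s - 1) / l = q"
      using True unfolding s2[symmetric] by (simp add: power2_eq_square algebra_simps)
    then have "real (card V) \<le> 1 + real k + real k * (real p + 1)"
      using sphere_tests_radius_1[of "card V" k q p] tests k'(2) q2 by simp
    also have "\<dots> = real (1 + k + k * (p + 1))" by (simp add: distrib_left)
    finally have v: "card V \<le> 1 + k + k * (p + 1)" by (simp only: of_nat_le_iff)
    have M1: "(\<Sum>j=0..2*l-1. k * q ^ j) = k + k * q" using True by (simp add: eval_nat_numeral)
    have kpos: "k > 0" using k'(2) p by simp
    \<comment> \<open>Hence \<open>p + 1 \<le> 2 * p \<le> m * p = q\<close>, with equality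
      throughout only for \<open>p = 1\<close> and \<open>m = 2\<close>.\<close>
    have "2 * p \<le> m * p" using m by (intro mult_le_mono) auto
    then have pq: "p + 1 \<le> q" using p q' by linarith
    show ?thesis
    proof (cases "p + 1 = q")
      case True
      then have "p = 1" using \<open>2 * p \<le> m * p\<close> q' p by linarith
      then have "m = 2" using True q' by simp
      have "card V \<le> 1 + (\<Sum>j=0..2*l-1. k * q ^ j)" using v M1 unfolding True by simp
      then show ?thesis using \<open>p = 1\<close> \<open>m = 2\<close> p m \<open>l = 1\<close> by auto
    next
      case False
      then have "k * (p + 1) < k * q" using pq kpos by (intro mult_strict_left_mono) auto
      then show ?thesis using v M1 by linarith
    qed
  next
    case False
    then have "real (card V) < 1 + k * (\<Sum>j<2*l. real q ^ j)"
      using sphere_tests_order_bound[OF p(1) m(1) _ k'(1) q' s_def tests] l by simp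
    also have "\<dots> = real (1 + k * (\<Sum>j<2*l. q ^ j))" by simp
    finally show ?thesis unfolding M of_nat_less_iff by simp
  qed
qed simp

end

section \<open>The Petersen graph\<close>

text \<open>Adding all rows of the characteristic matrix to the first one splits off the factor
  \<open>x - k\<close>; the condition on \<open>v\<close> says that \<open>k\<close> is not a root of the cofactor.\<close>

lemma order_char_poly_column_sum:
  fixes A :: "'b :: field mat"
  assumes A: "A \<in> carrier_mat n n" and n: "n > 0"
    and col: "\<And>j. j < n \<Longrightarrow> (\<Sum>i<n. A $$ (i, j)) = k"
    and ker: "\<And>v. v \<in> carrier_vec n \<Longrightarrow> A *\<^sub>v v = k \<cdot>\<^sub>v v \<Longrightarrow> (\<Sum>i<n. v $ i) = 0 \<Longrightarrow> v = 0\<^sub>v n"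
  shows "order k (char_poly A) = 1"
proof -
  define X where "X = char_poly_matrix A"
  \<comment> \<open>\<open>L\<close> adds all rows to the first one, \<open>D\<close> carries the
    extracted factor, \<open>M\<close> is what remains, and \<open>N\<close> is \<open>M\<close>
    evaluated at \<open>k\<close>.\<close>
  define L :: "'b poly mat" where "L = mat n n (\<lambda>(i, j). if i = 0 \<or> i = j then 1 else 0)"
  define D where "D = mat n n (\<lambda>(i, j). if i = j then if i = 0 then [:-k, 1:] else 1 else 0)"
  define M where "M = mat n n (\<lambda>(i, j). if i = 0 then 1 else X $$ (i, j))"
  define N where "N = mat n n (\<lambda>(i, j). if i = 0 then 1 else (if i = j then k else 0) - A $$ (i, j))"
  have X: "X $$ (i, j) = (if i = j then [:0, 1:] else 0) - [:A $$ (i, j):]" if "i < n" "j < n" for i j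
    using that A by (simp add: X_def char_poly_matrix_def)
  have carrier: "X \<in> carrier_mat n n" "L \<in> carrier_mat n n" "D \<in> carrier_mat n n"
    "M \<in> carrier_mat n n" "N \<in> carrier_mat n n"
    using A by (auto simp: X_def L_def D_def M_def N_def)
  have "L * X = D * M"
  proof (rule eq_matI)
    fix i j assume "i < dim_row (D * M)" "j < dim_col (D * M)"
    then have ij: "i < n" "j < n" using carrier by auto
    have "(L * X) $$ (i, j) = (\<Sum>m<n. (if i = 0 \<or> i = m then 1 else 0) * X $$ (m, j))"
      using ij carrier by (simp add: scalar_prod_def L_def lessThan_atLeast0)
    also have "\<dots> = (if i = 0 then [:-k, 1:] else X $$ (i, j))"
    proof (cases "i = 0")
      case True
      have "(\<Sum>m<n. X $$ (m, j)) = (\<Sum>m<n. if m = j then [:0, 1:] else 0) - [:\<Sum>m<n. A $$ (m, j):]"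
        using ij by (simp add: X sum_subtractf flip: sum_to_poly)
      also have "\<dots> = [:-k, 1:]" using ij by (simp add: col)
      finally show ?thesis using True by simp
    next
      case False
      then show ?thesis using ij by (simp add: if_distrib[of "\<lambda>x. x * _"] cong: if_cong)
    qed
    also have "\<dots> = (\<Sum>m<n. (if i = m then if i = 0 then [:-k, 1:] else 1 else 0) * M $$ (m, j))"
      using ij by (simp add: if_distrib[of "\<lambda>x. x * _"] M_def cong: if_cong)
    also have "\<dots> = (D * M) $$ (i, j)"
      using ij carrier by (simp add: scalar_prod_def D_def lessThan_atLeast0)
    finally show "(L * X) $$ (i, j) = (D * M) $$ (i, j)" .
  qed (use carrier in auto)
  then have "det L * det X = det D * det M"
    using carrier by (metis det_mult)
  moreover have "det L = 1"
  proof -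
    have "upper_triangular L" by (auto simp: L_def)
    then have "det L = prod_list (diag_mat L)" using carrier by (intro det_upper_triangular)
    also have "diag_mat L = map (\<lambda>i. 1) [0..<n]" unfolding diag_mat_def L_def by (simp cong: map_cong)
    finally show ?thesis by (simp add: map_replicate_const)
  qed
  moreover have "det D = [:-k, 1:]"
  proof -
    have "upper_triangular D" by (auto simp: D_def)
    then have "det D = prod_list (diag_mat D)" using carrier by (intro det_upper_triangular)
    also have "diag_mat D = [:-k, 1:] # map (\<lambda>i. 1) [1..<n]"
      using n unfolding diag_mat_def D_def by (simp add: upt_conv_Cons cong: map_cong)
    finally show ?thesis by (simp add: map_replicate_const)
  qed
  ultimately have chi: "char_poly A = [:-k, 1:] * det M" by (simp add: char_poly_def X_def)
  have "poly (det M) k = det N"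
    by (rule poly_det_cong[OF carrier(5,4)]) (auto simp: M_def N_def X)
  moreover have "det N \<noteq> 0"
  proof
    assume "det N = 0"
    then obtain v where v: "v \<in> carrier_vec n" "v \<noteq> 0\<^sub>v n" "N *\<^sub>v v = 0\<^sub>v n"
      using det_0_iff_vec_prod_zero_field[OF carrier(5)] by blast
    define d where "d i = k * v $ i - (\<Sum>j<n. A $$ (i, j) * v $ j)" for i
    have N: "(\<Sum>j<n. N $$ (i, j) * v $ j) = 0" if "i < n" for i
    proof -
      have "(\<Sum>j<n. N $$ (i, j) * v $ j) = (N *\<^sub>v v) $ i"
        using that carrier v(1) by (simp add: scalar_prod_def lessThan_atLeast0)
      then show ?thesis using v(3) that by simp
    qed
    have s0: "(\<Sum>j<n. v $ j) = 0" using N[OF n] n by (simp add: N_def)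
    have d: "d i = 0" if "0 < i" "i < n" for i
    proof -
      have "(\<Sum>j<n. N $$ (i, j) * v $ j) = (\<Sum>j<n. (if i = j then k else 0) * v $ j - A $$ (i, j) * v $ j)"
        using that by (intro sum.cong) (auto simp: N_def left_diff_distrib)
      also have "\<dots> = d i"
        using that by (simp add: d_def sum_subtractf if_distrib[of "\<lambda>x. x * _"] cong: if_cong)
      finally show ?thesis using N that by simp
    qed
    \<comment> \<open>The rows of \<open>N\<close> after the first give \<open>d i = 0\<close> for
      \<open>i > 0\<close>. Row 0 is recovered because, by the column sums, all \<open>d i\<close>
      add up to zero.\<close>
    have "(\<Sum>i<n. d i) = k * (\<Sum>i<n. v $ i) - (\<Sum>j<n. (\<Sum>i<n. A $$ (i, j)) * v $ j)"
      unfolding d_def sum_subtractf sum_distrib_left sum_distrib_right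
      by (subst (2) sum.swap) simp
    also have "\<dots> = 0" using s0 by (simp add: col flip: sum_distrib_left)
    finally have "d 0 = 0"
      using d n by (subst (asm) sum.remove[of _ 0]) auto
    with d have d: "d i = 0" if "i < n" for i using that by (cases "i = 0") auto
    have "A *\<^sub>v v = k \<cdot>\<^sub>v v"
    proof (rule eq_vecI)
      fix i assume "i < dim_vec (k \<cdot>\<^sub>v v)"
      then have "i < n" using v by simp
      then show "(A *\<^sub>v v) $ i = (k \<cdot>\<^sub>v v) $ i"
        using d[of i] A v by (simp add: d_def scalar_prod_def lessThan_atLeast0)
    qed (use A v in simp)
    then show False using ker v s0 by blast
  qed
  ultimately have M: "poly (det M) k \<noteq> 0" by simp
  then have "det M \<noteq> 0" by auto
  then have "order k (char_poly A) = order k [:-k, 1:] + order k (det M)"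
    unfolding chi by (intro order_mult) (simp only: mult_eq_0_iff, simp)
  then show ?thesis using order_power_n_n[of k 1] order_0I[OF M] by simp
qed

section \<open>Multiplicity of the top eigenvalue and an upper bound for the second\<close>

context regular_uniform_hg
begin

text \<open>Eigenfunctions for this value are constant, so only 0 has sum zero; this is the kernel
  condition of \<open>order_char_poly_column_sum\<close>. Its column sums are row sums by
  symmetry.\<close>

lemma count_top_eigenvalue:
  assumes "V \<noteq> {}"
  shows "count (eigenvalues_hg V E) (real (r * (u - 1))) = 1"
proof -
  let ?k = "real (r * (u - 1))"
  obtain vs where vs: "distinct vs" "set vs = V"
    "eigenvalues_hg V E = proots (char_poly (adjacency_matrix vs E))"
    using eigenvalues_hg_obtain[OF finite_V] .
  let ?A = "adjacency_matrix vs E" and ?n = "length vs"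
  have n: "?n > 0" using assms vs(2) by auto
  have sum_nth: "(\<Sum>i<?n. g (vs ! i)) = (\<Sum>x\<in>V. g x)" for g :: "'a \<Rightarrow> real"
    by (rule sum.reindex_bij_betw[OF bij_betw_nth]) (use vs in auto)
  have "order ?k (char_poly ?A) = 1"
  proof (rule order_char_poly_column_sum[OF adjacency_matrix_carrier n])
    fix j assume j: "j < ?n"
    have "(\<Sum>i<?n. ?A $$ (i, j)) = (\<Sum>i<?n. adj E (vs ! j) (vs ! i))"
      using j vs(1) by (intro sum.cong)
        (auto simp: adjacency_matrix_def adj_def nth_eq_iff_index_eq insert_commute)
    also have "\<dots> = ?k"
      unfolding sum_nth by (rule row_sum) (use j vs(2) nth_mem in blast)
    finally show "(\<Sum>i<?n. ?A $$ (i, j)) = ?k" .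
  next
    fix v assume v: "v \<in> carrier_vec ?n" "?A *\<^sub>v v = ?k \<cdot>\<^sub>v v" "(\<Sum>i<?n. v $ i) = 0"
    obtain f where f: "\<And>i. i < ?n \<Longrightarrow> f (vs ! i) = v $ i"
      "\<And>x. x \<in> V \<Longrightarrow> (\<Sum>y\<in>V. adj E x y * f y) = ?k * f x"
      by (rule adjacency_matrix_eigenvector_function[OF vs(1,2) v(1,2)]) (rule that)
    have const: "f y = f x" if "x \<in> V" "y \<in> V" for x y
      by (rule top_eigenvector_constant[OF f(2) that])
    have s: "(\<Sum>x\<in>V. f x) = 0" using v(3) f(1) by (simp flip: sum_nth)
    have "f x = 0" if x: "x \<in> V" for x
    proof -
      have "(\<Sum>y\<in>V. f y) = (\<Sum>y\<in>V. f x)" by (rule sum.cong[OF refl], rule const[OF x])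
      then have "card V * f x = 0" using s by simp
      then show ?thesis using assms finite_V by simp
    qed
    then have "v $ i = 0" if "i < ?n" for i using f(1)[OF that] nth_mem[OF that] vs(2) by metis
    then show "v = 0\<^sub>v ?n" using v(1) by (intro eq_vecI) auto
  qed
  then show ?thesis
    unfolding vs(3) by (simp add: count_proots[OF char_poly_nonzero[OF adjacency_matrix_carrier]])
qed

text \<open>The entry at index 1 is meaningful only if there are two eigenvalues. Another one
  besides the top is obtained from \<open>rayleigh_maximiser\<close>; simplicity of the top
  eigenvalue then allows \<open>second_largest_le\<close>.\<close>

lemma second_eigenvalue_le:
  assumes card: "card V \<ge> 2"
    and b: "\<And>c. c \<in># eigenvalues_hg V E \<Longrightarrow> c = real (r * (u - 1)) \<or> c \<le> b"
  shows "second_eigenvalue V E \<le> b"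
proof -
  let ?k = "real (r * (u - 1))"
  have ne: "V \<noteq> {}" using card by auto
  then obtain x where x: "x \<in> V" by blast
  have "V \<noteq> {x}" using card by auto
  then obtain y where y: "y \<in> V" "y \<noteq> x" using x by blast
  define f where "f z = (if z = x then 1 else if z = y then -1 else 0 :: real)" for z
  have f0: "(\<Sum>z\<in>V. f z) = 0"
  proof -
    have "(\<Sum>z\<in>V. f z) = (\<Sum>z\<in>{x, y}. f z)"
      using x y finite_V by (intro sum.mono_neutral_right) (auto simp: f_def)
    then show ?thesis using y by (simp add: f_def)
  qed
  define F where "F = (\<Sum>x\<in>V. \<Sum>y\<in>V. adj E x y * f x * f y)"
  define N where "N = (\<Sum>z\<in>V. (f z)\<^sup>2)"
  have "(f x)\<^sup>2 \<le> N" unfolding N_def using x finite_V by (intro member_le_sum) auto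
  then have N: "N > 0" by (simp add: f_def)
  \<comment> \<open>\<open>F / N - 1\<close> is just some number below the Rayleigh quotient of
    \<open>f\<close>; only the existence of a sum-zero eigenfunction is wanted.\<close>
  then have "F > (F / N - 1) * N" by (simp add: field_simps)
  then obtain \<rho> g where g: "(\<Sum>z\<in>V. g z) = 0" "\<exists>z\<in>V. g z \<noteq> 0"
      "\<And>z. z \<in> V \<Longrightarrow> (\<Sum>y\<in>V. adj E z y * g y) = \<rho> * g z"
    using rayleigh_maximiser[OF finite_V adj_sym row_sum f0] unfolding F_def N_def by blast
  have \<rho>: "\<rho> \<in># eigenvalues_hg V E"
    unfolding mem_eigenvalues_hg_iff[OF finite_V] using g by blast
  have "\<rho> \<noteq> ?k"
  proof
    assume eq: "\<rho> = ?k"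
    obtain x where x: "x \<in> V" "g x \<noteq> 0" using g(2) by blast
    have "(\<Sum>y\<in>V. g y) = (\<Sum>y\<in>V. g x)"
      by (rule sum.cong[OF refl], rule top_eigenvector_constant[OF _ x(1)]) (use g(3) eq in auto)
    then show False using g(1) x(2) ne finite_V by simp
  qed
  have k: "?k \<in># eigenvalues_hg V E"
    using count_top_eigenvalue[OF ne] by (simp flip: count_greater_zero_iff)
  have "{#?k, \<rho>#} \<subseteq># eigenvalues_hg V E"
    using k \<rho> \<open>\<rho> \<noteq> ?k\<close> by (auto simp: insert_subset_eq_iff in_diff_count)
  then have "size (eigenvalues_hg V E) \<ge> 2" using size_mset_mono by fastforce
  then show ?thesis
    unfolding second_eigenvalue_def
    by (rule second_largest_le[where c = ?k]) (use count_top_eigenvalue[OF ne] b in auto)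
qed

end

section \<open>Counting, connectedness and girth in the Petersen graph\<close>

lemma petersen_verts_card:
  assumes "A \<subseteq> {..<5}"
  shows "card {B \<in> petersen_verts. A \<inter> B = {}} = (5 - card A) choose 2"
proof -
  have "{B \<in> petersen_verts. A \<inter> B = {}} = {B. B \<subseteq> {..<5} - A \<and> card B = 2}"
    by (auto simp: petersen_verts_def)
  moreover have "card ({..<5} - A) = 5 - card A"
    using assms by (simp add: card_Diff_subset finite_subset[of A "{..<5}"])
  ultimately show ?thesis by (simp add: n_subsets)
qed

lemma petersen_verts_nonempty: "A \<in> petersen_verts \<Longrightarrow> A \<noteq> {}"
  by (auto simp: petersen_verts_def)

lemma finite_petersen_verts: "finite petersen_verts"
  by (rule finite_subset[of _ "Pow {..<5}"]) (auto simp: petersen_verts_def)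

lemma card_petersen_verts: "card petersen_verts = 10"
proof -
  have "petersen_verts = {B \<in> petersen_verts. {} \<inter> B = {}}" by simp
  then show ?thesis using petersen_verts_card[of "{}"] by (simp add: choose_two)
qed

lemma petersen_edge_iff:
  assumes "A \<in> petersen_verts" "B \<in> petersen_verts"
  shows "{A, B} \<in> petersen_edges \<longleftrightarrow> A \<inter> B = {}"
  using assms by (auto simp: petersen_edges_def doubleton_eq_iff)

lemma hypergraph_petersen: "hypergraph petersen_verts petersen_edges"
  and uniform_petersen: "uniform_hg 2 petersen_edges"
proof -
  have "card e = 2 \<and> e \<subseteq> petersen_verts" if "e \<in> petersen_edges" for e
  proof -
    obtain A B where e: "e = {A, B}" "A \<in> petersen_verts" "B \<in> petersen_verts" "A \<inter> B = {}"
      using \<open>e \<in> petersen_edges\<close> by (auto simp: petersen_edges_def)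
    then have "A \<noteq> B" using petersen_verts_nonempty by blast
    then show ?thesis using e by simp
  qed
  then show "hypergraph petersen_verts petersen_edges" "uniform_hg 2 petersen_edges"
    by (auto simp: hypergraph_def uniform_hg_def finite_petersen_verts)
qed

lemma petersen_edges_at:
  assumes "A \<in> petersen_verts"
  shows "{e \<in> petersen_edges. A \<in> e} = (\<lambda>B. {A, B}) ` {B \<in> petersen_verts. A \<inter> B = {}}"
  using assms by (auto simp: petersen_edges_def insert_commute)

lemma regular_petersen: "regular_hg 3 petersen_verts petersen_edges"
  unfolding regular_hg_def
proof
  fix A assume A: "A \<in> petersen_verts"
  have "inj_on (\<lambda>B. {A, B}) {B \<in> petersen_verts. A \<inter> B = {}}"
    by (auto simp: inj_on_def doubleton_eq_iff)
  then have "card {e \<in> petersen_edges. A \<in> e} = card {B \<in> petersen_verts. A \<inter> B = {}}"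
    unfolding petersen_edges_at[OF A] by (rule card_image)
  also have "\<dots> = 3"
    using A by (subst petersen_verts_card) (auto simp: petersen_verts_def choose_two)
  finally show "card {e \<in> petersen_edges. A \<in> e} = 3" .
qed

lemma adj_petersen:
  assumes "A \<in> petersen_verts" "B \<in> petersen_verts"
  shows "adj petersen_edges A B = (if A \<inter> B = {} then 1 else 0)"
proof (cases "A = B")
  case True
  then show ?thesis using petersen_verts_nonempty[OF assms(1)] by (simp add: adj_def)
next
  case False
  have "{e \<in> petersen_edges. {A, B} \<subseteq> e} = (if A \<inter> B = {} then {{A, B}} else {})"
    using assms False by (auto simp: petersen_edges_def)
  then show ?thesis using False by (simp add: adj_def)
qed

lemma card_Un_petersen_verts:
  assumes "A \<in> petersen_verts" "B \<in> petersen_verts"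
  shows "card (A \<union> B) = (if A = B then 2 else if A \<inter> B = {} then 4 else 3)"
proof -
  have fin: "finite A" "finite B" "card A = 2" "card B = 2"
    using assms by (auto simp: petersen_verts_def intro: finite_subset)
  then have un: "card (A \<union> B) + card (A \<inter> B) = 4" using card_Un_Int[of A B] by simp
  show ?thesis
  proof (cases "A = B")
    case False
    have "card (A \<inter> B) < 2"
    proof (rule ccontr)
      assume "\<not> card (A \<inter> B) < 2"
      then have "A \<inter> B = A" "A \<inter> B = B" using fin by (intro card_seteq; simp)+
      then show False using False by blast
    qed
    moreover have "card (A \<inter> B) = 0 \<longleftrightarrow> A \<inter> B = {}" using fin by simp
    ultimately show ?thesis using un False by auto
  qed (use fin in simp)
qed

text \<open>A common neighbour is a 2-subset of the complement of \<open>A \<union> B\<close>, which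
  has 3, 1 or 2 points. These counts make the graph strongly regular.\<close>

lemma petersen_common_neighbours:
  assumes "A \<in> petersen_verts" "B \<in> petersen_verts"
  shows "card {C \<in> petersen_verts. (A \<union> B) \<inter> C = {}} = (if A = B then 3 else if A \<inter> B = {} then 0 else 1)"
proof -
  have "A \<union> B \<subseteq> {..<5}" using assms by (auto simp: petersen_verts_def)
  then show ?thesis
    using assms by (simp only: petersen_verts_card card_Un_petersen_verts) (simp add: choose_two)
qed

lemma connected_petersen: "connected_hg petersen_verts petersen_edges"
  unfolding connected_hg_def
proof (intro ballI)
  fix A B assume AB: "A \<in> petersen_verts" "B \<in> petersen_verts"
  have step: "A \<noteq> B" if "A \<inter> B = {}" "A \<in> petersen_verts" for A B
    using that petersen_verts_nonempty by blast
  consider "A = B" | "A \<inter> B = {}" | "A \<noteq> B" "A \<inter> B \<noteq> {}" by blast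
  then show "\<exists>xs es. walk_hg petersen_verts petersen_edges xs es \<and> hd xs = A \<and> last xs = B"
  proof cases
    case 1
    then show ?thesis using AB by (intro exI[of _ "[A]"] exI[of _ "[]"]) (simp add: walk_hg_def)
  next
    case 2
    then show ?thesis using AB step[of A B]
      by (intro exI[of _ "[A, B]"] exI[of _ "[{A, B}]"]) (simp add: walk_hg_def petersen_edge_iff)
  next
    case 3
    \<comment> \<open>Distinct non-adjacent vertices have exactly one common neighbour, so a walk of
      length 2 joins them.\<close>
    then have "{C \<in> petersen_verts. (A \<union> B) \<inter> C = {}} \<noteq> {}"
      using petersen_common_neighbours[OF AB] by (metis card.empty one_neq_zero)
    then obtain C where C: "C \<in> petersen_verts" "A \<inter> C = {}" "C \<inter> B = {}" by blast
    then show ?thesis using AB step[of A C] step[of C B]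
      by (intro exI[of _ "[A, C, B]"] exI[of _ "[{A, C}, {C, B}]"])
         (auto simp: walk_hg_def petersen_edge_iff less_Suc_eq)
  qed
qed

interpretation petersen: regular_uniform_hg petersen_verts petersen_edges 3 2
  by unfold_locales (fact hypergraph_petersen connected_petersen regular_petersen uniform_petersen)+

text \<open>A closed walk of length 1 would repeat a vertex in one step. In a closed walk of length
  2 both edges consist of the same two vertices, so they are not distinct.\<close>

lemma girth_petersen: "girth_hg petersen_verts petersen_edges \<ge> 3"
  unfolding girth_hg_def
proof (rule Inf_greatest, clarify)
  fix xs es assume c: "berge_cycle petersen_verts petersen_edges xs es"
  then have w: "length xs = length es + 1" "set es \<subseteq> petersen_edges"
      "\<And>i. i < length es \<Longrightarrow> xs ! i \<in> es ! i \<and> xs ! Suc i \<in> es ! i \<and> xs ! i \<noteq> xs ! Suc i"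
    and es: "es \<noteq> []" "hd xs = last xs" "distinct es"
    by (auto simp: berge_cycle_def walk_hg_def)
  have last: "xs ! 0 = xs ! length es"
  proof -
    have "xs \<noteq> []" "length xs - 1 = length es" using w(1) by auto
    then show ?thesis using es(2) by (simp add: hd_conv_nth last_conv_nth)
  qed
  have "length es \<noteq> 1"
  proof
    assume 1: "length es = 1"
    show False using w(3)[of 0] last unfolding 1 by simp
  qed
  moreover have "length es \<noteq> 2"
  proof
    assume 2: "length es = 2"
    have e: "es ! 0 \<in> petersen_edges" "es ! 1 \<in> petersen_edges" using 2 w(2) by (auto simp: subset_iff)
    have pair: "e = {a, b}" if "e \<in> petersen_edges" "a \<in> e" "b \<in> e" "a \<noteq> b" for e a b
    proof -
      have "card e = 2" using uniform_petersen that(1) by (simp add: uniform_hg_def)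
      then show ?thesis using that by (auto simp: card_2_iff)
    qed
    have "es ! 0 = {xs ! 0, xs ! 1}" using w(3)[of 0] 2 e by (intro pair) auto
    moreover have "es ! 1 = {xs ! 0, xs ! 1}"
      using w(3)[of 1] 2 e last by (intro pair) (auto simp: numeral_2_eq_2)
    ultimately show False using nth_eq_iff_index_eq[OF es(3), of 0 1] 2 by simp
  qed
  ultimately have "length es \<ge> 3" using length_0_conv[of es] es(1) by linarith
  then show "3 \<le> enat (length es)" by (simp add: numeral_eq_enat)
qed

text \<open>The adjacency matrix satisfies \<open>A\<^sup>2 + A - 2 I = J\<close>.\<close>

lemma petersen_eigenvalue:
  assumes "c \<in># eigenvalues_hg petersen_verts petersen_edges"
  shows "c = 3 \<or> c \<le> 1"
proof -
  let ?V = petersen_verts and ?a = "adj petersen_edges"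
  obtain f A where f: "\<And>A. A \<in> ?V \<Longrightarrow> (\<Sum>B\<in>?V. ?a A B * f B) = c * f A"
    and A: "A \<in> ?V" "f A \<noteq> 0"
    using assms unfolding mem_eigenvalues_hg_iff[OF finite_petersen_verts] by blast
  define s where "s = (\<Sum>B\<in>?V. f B)"
  have square: "(\<Sum>B\<in>?V. ?a A B * ?a B C) = 1 + 2 * (if A = C then 1 else 0) - ?a A C"
    if C: "C \<in> ?V" for C
  proof -
    have "(\<Sum>B\<in>?V. ?a A B * ?a B C) = (\<Sum>B\<in>?V. if (A \<union> C) \<inter> B = {} then 1 else 0)"
    proof (rule sum.cong[OF refl])
      fix B assume B: "B \<in> ?V"
      have "(A \<union> C) \<inter> B = {} \<longleftrightarrow> A \<inter> B = {} \<and> B \<inter> C = {}" by blast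
      then show "?a A B * ?a B C = (if (A \<union> C) \<inter> B = {} then 1 else 0)"
        using A(1) B C by (simp add: adj_petersen)
    qed
    also have "\<dots> = card {B \<in> ?V. (A \<union> C) \<inter> B = {}}"
      using finite_petersen_verts by (simp add: sum.If_cases Int_def)
    also have "\<dots> = 1 + 2 * (if A = C then 1 else 0) - ?a A C"
      unfolding petersen_common_neighbours[OF A(1) C] adj_petersen[OF A(1) C]
      using petersen_verts_nonempty[OF A(1)] by auto
    finally show ?thesis .
  qed
  have "c * (c * f A) = (\<Sum>B\<in>?V. ?a A B * (c * f B))"
    using f[OF A(1)] by (simp add: sum_distrib_left[symmetric] mult.left_commute)
  also have "\<dots> = (\<Sum>B\<in>?V. ?a A B * (\<Sum>C\<in>?V. ?a B C * f C))"
    by (rule sum.cong) (simp_all add: f)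
  also have "\<dots> = (\<Sum>C\<in>?V. (\<Sum>B\<in>?V. ?a A B * ?a B C) * f C)"
    unfolding sum_distrib_left sum_distrib_right by (subst sum.swap) (simp add: mult.assoc)
  also have "\<dots> = (\<Sum>C\<in>?V. (1 + 2 * (if A = C then 1 else 0) - ?a A C) * f C)"
    by (rule sum.cong) (simp_all add: square)
  also have "\<dots> = (\<Sum>C\<in>?V. f C + 2 * (if A = C then f C else 0) - ?a A C * f C)"
    by (rule sum.cong) (auto simp: algebra_simps)
  also have "\<dots> = s + 2 * f A - c * f A"
    using A(1) f[OF A(1)] finite_petersen_verts
    by (simp add: sum_subtractf sum.distrib s_def flip: sum_distrib_left)
  finally have eq: "c * (c * f A) = s + 2 * f A - c * f A" .
  \<comment> \<open>Summing the eigenvalue equation over all vertices gives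
    \<open>c * s = 3 * s\<close>. So an eigenvalue other than 3 has \<open>s = 0\<close> and is a
    root of \<open>(c - 1) * (c + 2)\<close>.\<close>
  have "c * s = (\<Sum>A\<in>?V. \<Sum>B\<in>?V. ?a A B * f B)" by (simp add: s_def sum_distrib_left f)
  also have "\<dots> = (\<Sum>B\<in>?V. (\<Sum>A\<in>?V. ?a B A) * f B)"
    unfolding sum_distrib_right by (subst sum.swap) (simp add: adj_sym)
  also have "\<dots> = 3 * s" by (simp add: petersen.row_sum s_def sum_distrib_left)
  finally have "c = 3 \<or> s = 0" by auto
  moreover have "c \<le> 1" if "s = 0"
  proof -
    have "(c - 1) * (c + 2) * f A = 0" using eq that by (simp add: algebra_simps)
    then show ?thesis using A(2) by auto
  qed
  ultimately show ?thesis by blast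
qed

text \<open>For \<open>r = 3\<close>, \<open>u = 2\<close>, \<open>l = 1\<close> the terms
  \<open>2 * sqrt q\<close> cancel and the assumed spectral bound is 1.\<close>

lemma second_eigenvalue_petersen: "second_eigenvalue petersen_verts petersen_edges \<le> 1"
  by (rule petersen.second_eigenvalue_le) (use petersen_eigenvalue card_petersen_verts in auto)

theorem theorem6p7:
  fixes r u l k q :: nat
  assumes "r \<ge> 3" and "u \<ge> 2" and "l \<ge> 1"
    and "k = r * (u - 1)" and "q = (r - 1) * (u - 1)"
  shows "(\<forall>(V :: 'a set) E.
             hypergraph V E \<and> connected_hg V E \<and> regular_hg r V E \<and> uniform_hg u E \<and>
             girth_hg V E \<ge> 3 \<and>
             second_eigenvalue V E
               \<le> real u - 2 + 2 * sqrt (real q) - (2 * sqrt (real q) - 1) / real l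
           \<longrightarrow> card V \<le> 1 + (\<Sum>j=0..2*l-1. k * q ^ j) \<and>
               (card V = 1 + (\<Sum>j=0..2*l-1. k * q ^ j) \<longrightarrow> (r, u, l) = (3, 2, 1)))
       \<and> ((r, u, l) = (3, 2, 1) \<longrightarrow>
             hypergraph petersen_verts petersen_edges \<and>
             connected_hg petersen_verts petersen_edges \<and>
             regular_hg r petersen_verts petersen_edges \<and>
             uniform_hg u petersen_edges \<and>
             girth_hg petersen_verts petersen_edges \<ge> 3 \<and>
             second_eigenvalue petersen_verts petersen_edges
               \<le> real u - 2 + 2 * sqrt (real q) - (2 * sqrt (real q) - 1) / real l \<and>
             card petersen_verts = 1 + (\<Sum>j=0..2*l-1. k * q ^ j))"
proof (intro conjI allI impI; (elim conjE)?)
  fix V :: "'a set" and E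
  assume H: "hypergraph V E" "connected_hg V E" "regular_hg r V E" "uniform_hg u E"
    and b: "second_eigenvalue V E
               \<le> real u - 2 + 2 * sqrt (real q) - (2 * sqrt (real q) - 1) / real l"
  interpret regular_uniform_hg V E r u by unfold_locales (fact H)+
  note bound = order_bound[OF assms b]
  show "card V \<le> 1 + (\<Sum>j=0..2*l-1. k * q ^ j)" using bound by linarith
  show "(r, u, l) = (3, 2, 1)" if "card V = 1 + (\<Sum>j=0..2*l-1. k * q ^ j)"
    using bound that by linarith
next
  assume "(r, u, l) = (3, 2, 1)"
  then have rul: "r = 3" "u = 2" "l = 1" "k = 3" "q = 2" using assms by auto
  show "hypergraph petersen_verts petersen_edges" by (rule hypergraph_petersen)
  show "connected_hg petersen_verts petersen_edges" by (rule connected_petersen)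
  show "regular_hg r petersen_verts petersen_edges" unfolding rul by (rule regular_petersen)
  show "uniform_hg u petersen_edges" unfolding rul by (rule uniform_petersen)
  show "girth_hg petersen_verts petersen_edges \<ge> 3" by (rule girth_petersen)
  show "second_eigenvalue petersen_verts petersen_edges
      \<le> real u - 2 + 2 * sqrt (real q) - (2 * sqrt (real q) - 1) / real l"
    using second_eigenvalue_petersen unfolding rul by simp
  show "card petersen_verts = 1 + (\<Sum>j=0..2*l-1. k * q ^ j)"
    unfolding rul card_petersen_verts by (simp add: eval_nat_numeral)
qed

end
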